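(* Let $g_0=dr^2+\sin^2r\,d\theta^2$ be the standard metric on $S^2$ and let $\varphi_k:S^2\longrightarrow S^2$, $k=1,2,3,4$, be the $f_k$-biharmonic maps given by $$\varphi_1(r,\theta)=\left(\tfrac12\arccos\left(\sin^2\tfrac r2\right),2\theta\right),\quad f_1=\frac{4(1+\tan^2\frac r2)(1+2\tan^2\frac r2)^{3/2}}{3\tan^4\frac r2+9\tan^2\frac r2+6+\cot^2\frac r2};$$ $$\varphi_2(r,\theta)=(r,\sqrt3\,\theta),\quad f_2=\left|\frac{(\tan\frac r2)^{1+\sqrt3}(\tan^2\frac r2+7+4\sqrt3)(\tan^2\frac r2-2-\sqrt3)}{(1+\tan^2\frac r2)^2(\tan^2\frac r2-1)}\right|;$$ $$\varphi_3(r,\theta)=(r,-\sqrt3\,\theta),\quad f_3=\left|\frac{(\tan\frac r2)^{1-\sqrt3}(\tan^2\frac r2+7-4\sqrt3)(\tan^2\frac r2-2+\sqrt3)}{(1+\tan^2\frac r2)^2(\tan^2\frac r2-1)}\right|;$$ $$\varphi_4(r,\theta)=(r,\tfrac12\theta),\quad f_4=\left|\frac{\tan r\,\sin(\frac{\sqrt3}{2}r)}{\sqrt{\sin r}}\right|.$$ Let $\mathbf I:S^2\longrightarrow S^n$ ($n\ge3$) be the standard totally geodesic embedding. Then the map $\mathbf I\circ\varphi_k:(S^2,f_k^{-1}g_0)\longrightarrow S^n$ is a proper biharmonic map from the Riemann sphere with some singular points, for $k=1,2,3,4$. None of these maps is weakly conformal.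
   Context: For a smooth map $\phi:(M,g)\to(N,h)$ of Riemannian manifolds, $\tau(\phi)=\mathrm{Tr}_g\nabla d\phi$ is the tension field and $\tau_2(\phi)=\mathrm{Trace}_g(\nabla^\phi\nabla^\phi-\nabla^\phi_{\nabla^M})\tau(\phi)-\mathrm{Trace}_g R^N(d\phi,\tau(\phi))d\phi$ is the bitension field, with $R^N(X,Y)Z=[\nabla^N_X,\nabla^N_Y]Z-\nabla^N_{[X,Y]}Z$. The map is harmonic if $\tau(\phi)=0$, biharmonic if $\tau_2(\phi)=0$, and proper biharmonic if it is biharmonic but not harmonic. For a positive function $f$ on $M$, it is $f$-biharmonic if $f\tau_2(\phi)+(\Delta f)\tau(\phi)+2\nabla^\phi_{\mathrm{grad} f}\tau(\phi)=0$. On the standard 2-sphere, $(r,\theta)$ (resp. $(\rho,\phi)$ on the target, with metric $d\rho^2+\sin^2\rho\,d\phi^2$) are geodesic polar coordinates, with $0<r<\pi$ and $\theta$ the angular coordinate. A Riemann sphere here means $S^2$ with a metric $f^{-1}g_0$ conformal to $g_0$. The functions $f_k$ are smooth on $0<r<\pi$, except at $r=\frac\pi2,\,2\arctan\sqrt{2+\sqrt3}$ for $k=2$; at $r=\frac\pi2,\,2\arctan\sqrt{2-\sqrt3}$ for $k=3$; and at $r=\frac\pi2$ for $k=4$; for $k=1$ the singular points of $f_1^{-1}g_0$ are the two poles. A map $\phi:(M,g)\to(N,h)$ is weakly conformal if $\phi^*h=\mu g$ for some function $\mu\ge0$.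
   Formalization: Since √3θ, −√3θ and θ/2 are not well defined modulo 2π, each map is taken on S² minus the poles, the singular circles and one meridian θ=a, for an arbitrary branch a<θ<a+2π (a any real); for k=1 these domains together cover S² minus the poles. *)

theory Defs
  imports "HOL-Analysis.Analysis"
begin

section \<open>Smooth functions and Riemannian metrics on open subsets of Euclidean spaces\<close>

primrec Ck_on :: "nat \<Rightarrow> 'a::euclidean_space set \<Rightarrow> ('a \<Rightarrow> 'b::real_normed_vector) \<Rightarrow> bool" where
  "Ck_on 0 U F \<longleftrightarrow> continuous_on U F"
| "Ck_on (Suc k) U F \<longleftrightarrow>
     (\<forall>x\<in>U. F differentiable (at x)) \<and> (\<forall>u. Ck_on k U (\<lambda>x. frechet_derivative F (at x) u))"

definition smooth_on :: "'a::euclidean_space set \<Rightarrow> ('a \<Rightarrow> 'b::real_normed_vector) \<Rightarrow> bool" where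
  "smooth_on U F \<longleftrightarrow> (\<forall>k. Ck_on k U F)"

abbreviation Dir :: "('a::real_normed_vector \<Rightarrow> 'b::real_normed_vector) \<Rightarrow> 'a \<Rightarrow> 'a \<Rightarrow> 'b" where
  "Dir F x u \<equiv> frechet_derivative F (at x) u"

text \<open>A metric on a coordinate domain assigns to each point a bilinear form on the model space;
  tangent vectors at a point are elements of the model space.\<close>

type_synonym 'a metric = "'a \<Rightarrow> 'a \<Rightarrow> 'a \<Rightarrow> real"

definition riemannian_metric_on :: "'a::euclidean_space set \<Rightarrow> 'a metric \<Rightarrow> bool" where
  "riemannian_metric_on U g \<longleftrightarrow>
     (\<forall>x\<in>U. bilinear (g x) \<and> (\<forall>u v. g x u v = g x v u) \<and> (\<forall>u. u \<noteq> 0 \<longrightarrow> g x u u > 0)) \<and>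
     (\<forall>u v. smooth_on U (\<lambda>x. g x u v))"

definition sharp :: "'a::euclidean_space metric \<Rightarrow> 'a \<Rightarrow> ('a \<Rightarrow> real) \<Rightarrow> 'a" where
  "sharp g x \<alpha> = (THE w. \<forall>z. g x w z = \<alpha> z)"

text \<open>The coordinate expression \<open>\<Sum> g\<^sup>i\<^sup>j B(e\<^sub>i, e\<^sub>j)\<close>: the first argument of \<open>B\<close>
  is the vector with components \<open>g\<^sup>i\<^sup>j\<close>, \<open>j\<close> fixed.\<close>

definition trace_metric :: "'a::euclidean_space metric \<Rightarrow> 'a \<Rightarrow> ('a \<Rightarrow> 'a \<Rightarrow> 'b::real_vector) \<Rightarrow> 'b" where
  "trace_metric g x B = (\<Sum>b\<in>Basis. B (sharp g x (\<lambda>z. z \<bullet> b)) b)"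


section \<open>Levi-Civita connection and curvature\<close>

text \<open>Vector fields on a coordinate domain are functions from the model space to itself.
  The vector \<open>christoffel g x u v\<close> is \<open>\<nabla>\<^sub>U V\<close> at \<open>x\<close> for the constant fields with values
  \<open>u\<close> and \<open>v\<close>: the Koszul formula, in which the brackets of constant fields vanish.\<close>

definition christoffel :: "'a::euclidean_space metric \<Rightarrow> 'a \<Rightarrow> 'a \<Rightarrow> 'a \<Rightarrow> 'a" where
  "christoffel g x u v =
     sharp g x (\<lambda>z. (Dir (\<lambda>y. g y v z) x u + Dir (\<lambda>y. g y u z) x v - Dir (\<lambda>y. g y u v) x z) / 2)"

definition levi_civita ::
  "'a::euclidean_space metric \<Rightarrow> ('a \<Rightarrow> 'a) \<Rightarrow> ('a \<Rightarrow> 'a) \<Rightarrow> 'a \<Rightarrow> 'a" where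
  "levi_civita g X Y x = Dir Y x (X x) + christoffel g x (X x) (Y x)"

definition lie_bracket :: "('a::euclidean_space \<Rightarrow> 'a) \<Rightarrow> ('a \<Rightarrow> 'a) \<Rightarrow> 'a \<Rightarrow> 'a" where
  "lie_bracket X Y x = Dir Y x (X x) - Dir X x (Y x)"

definition curvature_field ::
  "'a::euclidean_space metric \<Rightarrow> ('a \<Rightarrow> 'a) \<Rightarrow> ('a \<Rightarrow> 'a) \<Rightarrow> ('a \<Rightarrow> 'a) \<Rightarrow> 'a \<Rightarrow> 'a" where
  "curvature_field g X Y Z x =
     levi_civita g X (levi_civita g Y Z) x - levi_civita g Y (levi_civita g X Z) x
     - levi_civita g (lie_bracket X Y) Z x"

text \<open>By tensoriality the value on tangent vectors may be computed on constant extensions; the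
  same device is used for the other tensorial expressions below.\<close>

definition curvature :: "'a::euclidean_space metric \<Rightarrow> 'a \<Rightarrow> 'a \<Rightarrow> 'a \<Rightarrow> 'a \<Rightarrow> 'a" where
  "curvature g x u v w = curvature_field g (\<lambda>_. u) (\<lambda>_. v) (\<lambda>_. w) x"

definition grad :: "'a::euclidean_space metric \<Rightarrow> ('a \<Rightarrow> real) \<Rightarrow> 'a \<Rightarrow> 'a" where
  "grad g f x = sharp g x (\<lambda>z. Dir f x z)"

definition laplacian :: "'a::euclidean_space metric \<Rightarrow> ('a \<Rightarrow> real) \<Rightarrow> 'a \<Rightarrow> real" where
  "laplacian g f x = trace_metric g x
     (\<lambda>u v. Dir (\<lambda>y. Dir f y v) x u - Dir f x (levi_civita g (\<lambda>_. u) (\<lambda>_. v) x))"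


section \<open>Harmonic, biharmonic, f-biharmonic and weakly conformal maps\<close>

text \<open>The connection on the pull-back bundle of a map \<open>\<phi>\<close> into a coordinate domain with metric
  \<open>h\<close>; a section \<open>V\<close> is given by its values in the model space of the target.\<close>

definition pullback_connection ::
  "'b::euclidean_space metric \<Rightarrow> ('a::euclidean_space \<Rightarrow> 'b) \<Rightarrow> ('a \<Rightarrow> 'a) \<Rightarrow> ('a \<Rightarrow> 'b) \<Rightarrow> 'a \<Rightarrow> 'b" where
  "pullback_connection h \<phi> X V x =
     Dir V x (X x) + christoffel h (\<phi> x) (Dir \<phi> x (X x)) (V x)"

definition second_fundamental_form ::
  "'a::euclidean_space metric \<Rightarrow> 'b::euclidean_space metric \<Rightarrow> ('a \<Rightarrow> 'b) \<Rightarrow> 'a \<Rightarrow> 'a \<Rightarrow> 'a \<Rightarrow> 'b" where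
  "second_fundamental_form g h \<phi> x u v =
     pullback_connection h \<phi> (\<lambda>_. u) (\<lambda>y. Dir \<phi> y v) x
     - Dir \<phi> x (levi_civita g (\<lambda>_. u) (\<lambda>_. v) x)"

definition tension ::
  "'a::euclidean_space metric \<Rightarrow> 'b::euclidean_space metric \<Rightarrow> ('a \<Rightarrow> 'b) \<Rightarrow> 'a \<Rightarrow> 'b" where
  "tension g h \<phi> x = trace_metric g x (second_fundamental_form g h \<phi> x)"

definition bitension ::
  "'a::euclidean_space metric \<Rightarrow> 'b::euclidean_space metric \<Rightarrow> ('a \<Rightarrow> 'b) \<Rightarrow> 'a \<Rightarrow> 'b" where
  "bitension g h \<phi> x =
     trace_metric g x (\<lambda>u v.
       pullback_connection h \<phi> (\<lambda>_. u) (pullback_connection h \<phi> (\<lambda>_. v) (tension g h \<phi>)) x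
       - pullback_connection h \<phi> (levi_civita g (\<lambda>_. u) (\<lambda>_. v)) (tension g h \<phi>) x)
     - trace_metric g x (\<lambda>u v.
         curvature h (\<phi> x) (Dir \<phi> x u) (tension g h \<phi> x) (Dir \<phi> x v))"

definition smooth_riemannian_map ::
  "'a::euclidean_space set \<Rightarrow> 'a metric \<Rightarrow> 'b::euclidean_space set \<Rightarrow> 'b metric \<Rightarrow> ('a \<Rightarrow> 'b) \<Rightarrow> bool" where
  "smooth_riemannian_map U g V h \<phi> \<longleftrightarrow>
     open U \<and> riemannian_metric_on U g \<and> open V \<and> riemannian_metric_on V h \<and>
     \<phi> \<in> U \<rightarrow> V \<and> smooth_on U \<phi>"

definition harmonic ::
  "'a::euclidean_space set \<Rightarrow> 'a metric \<Rightarrow> 'b::euclidean_space set \<Rightarrow> 'b metric \<Rightarrow> ('a \<Rightarrow> 'b) \<Rightarrow> bool" where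
  "harmonic U g V h \<phi> \<longleftrightarrow> smooth_riemannian_map U g V h \<phi> \<and> (\<forall>x\<in>U. tension g h \<phi> x = 0)"

definition biharmonic ::
  "'a::euclidean_space set \<Rightarrow> 'a metric \<Rightarrow> 'b::euclidean_space set \<Rightarrow> 'b metric \<Rightarrow> ('a \<Rightarrow> 'b) \<Rightarrow> bool" where
  "biharmonic U g V h \<phi> \<longleftrightarrow> smooth_riemannian_map U g V h \<phi> \<and> (\<forall>x\<in>U. bitension g h \<phi> x = 0)"

definition f_biharmonic ::
  "('a \<Rightarrow> real) \<Rightarrow> 'a::euclidean_space set \<Rightarrow> 'a metric \<Rightarrow> 'b::euclidean_space set \<Rightarrow> 'b metric
     \<Rightarrow> ('a \<Rightarrow> 'b) \<Rightarrow> bool" where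
  "f_biharmonic f U g V h \<phi> \<longleftrightarrow>
     smooth_riemannian_map U g V h \<phi> \<and> smooth_on U f \<and> (\<forall>x\<in>U. f x > 0) \<and>
     (\<forall>x\<in>U. f x *\<^sub>R bitension g h \<phi> x + laplacian g f x *\<^sub>R tension g h \<phi> x
        + 2 *\<^sub>R pullback_connection h \<phi> (grad g f) (tension g h \<phi>) x = 0)"

definition weakly_conformal ::
  "'a::euclidean_space set \<Rightarrow> 'a metric \<Rightarrow> 'b::euclidean_space set \<Rightarrow> 'b metric \<Rightarrow> ('a \<Rightarrow> 'b) \<Rightarrow> bool" where
  "weakly_conformal U g V h \<phi> \<longleftrightarrow>
     (\<exists>\<mu>. \<forall>x\<in>U. \<mu> x \<ge> 0 \<and> (\<forall>u v. h (\<phi> x) (Dir \<phi> x u) (Dir \<phi> x v) = \<mu> x * g x u v))"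


section \<open>Maps into round spheres\<close>

text \<open>The unit sphere of \<open>'e \<times> real\<close> has dimension \<open>DIM('e)\<close>. Its atlas consists of the two
  inverse stereographic projections, with \<open>s = 1\<close> missing the pole \<open>(0, -1)\<close> and \<open>s = -1\<close>
  missing \<open>(0, 1)\<close>.\<close>

definition inv_stereo :: "real \<Rightarrow> 'e::euclidean_space \<Rightarrow> 'e \<times> real" where
  "inv_stereo s y =
     ((2 / (1 + (norm y)\<^sup>2)) *\<^sub>R y, s * ((1 - (norm y)\<^sup>2) / (1 + (norm y)\<^sup>2)))"

definition induced_metric :: "('e::euclidean_space \<Rightarrow> 'p::euclidean_space) \<Rightarrow> 'e metric" where
  "induced_metric \<sigma> y u v = Dir \<sigma> y u \<bullet> Dir \<sigma> y v"

text \<open>A map \<open>\<Phi>\<close> from a coordinate domain into the sphere has a local property \<open>P\<close> if its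
  expression in every chart of the atlas has it; a chart is applied where \<open>\<Phi>\<close> takes values
  in its range.\<close>

definition in_sphere_charts ::
  "('a::euclidean_space set \<Rightarrow> 'e::euclidean_space set \<Rightarrow> 'e metric \<Rightarrow> ('a \<Rightarrow> 'e) \<Rightarrow> bool)
     \<Rightarrow> 'a set \<Rightarrow> ('a \<Rightarrow> 'e \<times> real) \<Rightarrow> bool" where
  "in_sphere_charts P U \<Phi> \<longleftrightarrow>
     open U \<and> continuous_on U \<Phi> \<and> \<Phi> \<in> U \<rightarrow> sphere 0 1 \<and>
     (\<forall>\<sigma>\<in>{inv_stereo 1, inv_stereo (-1)}.
        P (U \<inter> \<Phi> -` range \<sigma>) UNIV (induced_metric \<sigma>) (inv \<sigma> \<circ> \<Phi>))"

definition harmonic_to_sphere ::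
  "'a::euclidean_space set \<Rightarrow> 'a metric \<Rightarrow> ('a \<Rightarrow> 'e::euclidean_space \<times> real) \<Rightarrow> bool" where
  "harmonic_to_sphere U g \<Phi> \<longleftrightarrow> in_sphere_charts (\<lambda>W. harmonic W g) U \<Phi>"

definition biharmonic_to_sphere ::
  "'a::euclidean_space set \<Rightarrow> 'a metric \<Rightarrow> ('a \<Rightarrow> 'e::euclidean_space \<times> real) \<Rightarrow> bool" where
  "biharmonic_to_sphere U g \<Phi> \<longleftrightarrow> in_sphere_charts (\<lambda>W. biharmonic W g) U \<Phi>"

definition proper_biharmonic_to_sphere ::
  "'a::euclidean_space set \<Rightarrow> 'a metric \<Rightarrow> ('a \<Rightarrow> 'e::euclidean_space \<times> real) \<Rightarrow> bool" where
  "proper_biharmonic_to_sphere U g \<Phi> \<longleftrightarrow>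
     biharmonic_to_sphere U g \<Phi> \<and> \<not> harmonic_to_sphere U g \<Phi>"

definition f_biharmonic_to_sphere ::
  "('a \<Rightarrow> real) \<Rightarrow> 'a::euclidean_space set \<Rightarrow> 'a metric \<Rightarrow> ('a \<Rightarrow> 'e::euclidean_space \<times> real) \<Rightarrow> bool" where
  "f_biharmonic_to_sphere f U g \<Phi> \<longleftrightarrow> in_sphere_charts (\<lambda>W. f_biharmonic f W g) U \<Phi>"

definition weakly_conformal_to_sphere ::
  "'a::euclidean_space set \<Rightarrow> 'a metric \<Rightarrow> ('a \<Rightarrow> 'e::euclidean_space \<times> real) \<Rightarrow> bool" where
  "weakly_conformal_to_sphere U g \<Phi> \<longleftrightarrow> in_sphere_charts (\<lambda>W. weakly_conformal W g) U \<Phi>"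


section \<open>The maps\<close>

text \<open>The model of the 2-sphere is the unit sphere of \<open>(real \<times> real) \<times> real\<close>.\<close>

definition polar :: "real \<times> real \<Rightarrow> (real \<times> real) \<times> real" where
  "polar = (\<lambda>(r, \<theta>). ((sin r * cos \<theta>, sin r * sin \<theta>), cos r))"

definition g0 :: "(real \<times> real) metric" where
  "g0 x u v = fst u * fst v + (sin (fst x))\<^sup>2 * (snd u * snd v)"

definition conformal_metric :: "('a \<Rightarrow> real) \<Rightarrow> 'a metric \<Rightarrow> 'a metric" where
  "conformal_metric f g x u v = inverse (f x) * g x u v"

text \<open>The coordinate expressions of the maps, from polar coordinates to polar coordinates.\<close>

definition phi :: "nat \<Rightarrow> real \<times> real \<Rightarrow> real \<times> real" where
  "phi k = (\<lambda>(r, \<theta>).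
     if k = 1 then (arccos ((sin (r / 2))\<^sup>2) / 2, 2 * \<theta>)
     else if k = 2 then (r, sqrt 3 * \<theta>)
     else if k = 3 then (r, - sqrt 3 * \<theta>)
     else (r, \<theta> / 2))"

definition fk :: "nat \<Rightarrow> real \<times> real \<Rightarrow> real" where
  "fk k = (\<lambda>(r, \<theta>). let t = tan (r / 2) in
     if k = 1 then 4 * (1 + t^2) * (1 + 2 * t^2) powr (3/2)
                     / (3 * t^4 + 9 * t^2 + 6 + (cot (r / 2))^2)
     else if k = 2 then
       \<bar>t powr (1 + sqrt 3) * (t^2 + 7 + 4 * sqrt 3) * (t^2 - 2 - sqrt 3)
          / ((1 + t^2)^2 * (t^2 - 1))\<bar>
     else if k = 3 then
       \<bar>t powr (1 - sqrt 3) * (t^2 + 7 - 4 * sqrt 3) * (t^2 - 2 + sqrt 3)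
          / ((1 + t^2)^2 * (t^2 - 1))\<bar>
     else \<bar>tan r * sin (sqrt 3 / 2 * r) / sqrt (sin r)\<bar>)"

definition singular_radii :: "nat \<Rightarrow> real set" where
  "singular_radii k =
     (if k = 1 then {}
      else if k = 2 then {pi / 2, 2 * arctan (sqrt (2 + sqrt 3))}
      else if k = 3 then {pi / 2, 2 * arctan (sqrt (2 - sqrt 3))}
      else {pi / 2})"

text \<open>The angular coordinate is only defined modulo \<open>2 * pi\<close>, and only the first of the maps
  is independent of its choice: the multiples \<open>sqrt 3 * \<theta>\<close>, \<open>- sqrt 3 * \<theta>\<close> and \<open>\<theta> / 2\<close> depend
  on a branch. So the domain is taken relative to the branch with values in
  \<open>{a<..<a + 2 * pi}\<close>, and corresponds under \<open>polar\<close> to the sphere without the poles, the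
  singular circles and the meridian of angle \<open>a\<close>. The charts for varying \<open>a\<close> cover the
  sphere without the poles and the singular circles.\<close>

definition sphere_chart :: "nat \<Rightarrow> real \<Rightarrow> (real \<times> real) set" where
  "sphere_chart k a = {(r, \<theta>). 0 < r \<and> r < pi \<and> r \<notin> singular_radii k \<and> a < \<theta> \<and> \<theta> < a + 2 * pi}"

text \<open>The standard embedding of the 2-sphere into the sphere of \<open>(real ^ 'n) \<times> real\<close>, of
  dimension \<open>CARD('n)\<close>, as the great sphere in the coordinates \<open>i\<close>, \<open>j\<close> and the last one.\<close>

definition std_embedding :: "'n::finite \<Rightarrow> 'n \<Rightarrow> (real \<times> real) \<times> real \<Rightarrow> (real ^ 'n) \<times> real" where
  "std_embedding i j = (\<lambda>((x, y), z). (axis i x + axis j y, z))"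


text \<open>The form \<open>g0\<close> is the round metric in the coordinates \<open>polar\<close>, and these are coordinates
  on the sphere without a closed half meridian.\<close>

lemma g0_eq_induced_metric: "g0 = induced_metric polar"
proof (intro ext)
  fix x u v :: "real \<times> real"
  define D where "D = (\<lambda>w::real \<times> real.
    ((cos (fst x) * fst w * cos (snd x) - sin (fst x) * sin (snd x) * snd w,
      cos (fst x) * fst w * sin (snd x) + sin (fst x) * cos (snd x) * snd w),
     - sin (fst x) * fst w))"
  have "((\<lambda>w::real \<times> real. ((sin (fst w) * cos (snd w), sin (fst w) * sin (snd w)), cos (fst w)))
          has_derivative D) (at x)"
    unfolding D_def
    by (auto intro!: derivative_eq_intros simp: fun_eq_iff algebra_simps)
  then have "(polar has_derivative D) (at x)"
    by (simp add: polar_def case_prod_unfold)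
  then have "frechet_derivative polar (at x) = D"
    by (rule frechet_derivative_at [symmetric])
  moreover have "D u \<bullet> D v = g0 x u v"
  proof -
    have alg: "(c * p * c' - e * e' * q) * (c * p' * c' - e * e' * q')
        + (c * p * e' + e * c' * q) * (c * p' * e' + e * c' * q') + (- e * p) * (- e * p')
      = p * p' + e\<^sup>2 * (q * q')"
      if "e\<^sup>2 + c\<^sup>2 = 1" "e'\<^sup>2 + c'\<^sup>2 = 1" for c e c' e' p q p' q' :: real
      using that by algebra
    show ?thesis
      unfolding D_def g0_def inner_prod_def fst_conv snd_conv inner_real_def
      by (rule alg) (rule sin_cos_squared_add)+
  qed
  ultimately show "g0 x u v = induced_metric polar x u v"
    by (simp add: induced_metric_def)
qed

lemma polar_in_sphere: "polar x \<in> sphere 0 1"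
proof -
  obtain r \<theta> where x: "x = (r, \<theta>)" by force
  have "(sin r * cos \<theta>)\<^sup>2 + (sin r * sin \<theta>)\<^sup>2 + (cos r)\<^sup>2
      = (sin r)\<^sup>2 * ((sin \<theta>)\<^sup>2 + (cos \<theta>)\<^sup>2) + (cos r)\<^sup>2"
    by algebra
  also have "\<dots> = 1"
    by (simp only: sin_cos_squared_add mult_1_right)
  finally show ?thesis
    by (simp add: x polar_def norm_Pair)
qed

lemma inj_on_polar: "inj_on polar (sphere_chart k a)"
proof (rule inj_onI, clarify)
  fix r \<theta> r' \<theta>' :: real
  assume x: "(r, \<theta>) \<in> sphere_chart k a" and y: "(r', \<theta>') \<in> sphere_chart k a"
    and eq: "polar (r, \<theta>) = polar (r', \<theta>')"
  have "0 < r" "r < pi" "0 < r'" "r' < pi"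
    using x y by (simp_all add: sphere_chart_def)
  have "\<bar>\<theta> - \<theta>'\<bar> < 2 * pi"
    using x y unfolding sphere_chart_def by simp linarith
  have eqs: "sin r * cos \<theta> = sin r' * cos \<theta>'" "sin r * sin \<theta> = sin r' * sin \<theta>'" "cos r = cos r'"
    using eq by (simp_all add: polar_def)
  have r: "r = r'"
    by (rule cos_inj_pi) (use \<open>0 < r\<close> \<open>r < pi\<close> \<open>0 < r'\<close> \<open>r' < pi\<close> eqs(3) in simp_all)
  have "sin r' > 0"
    by (rule sin_gt_zero) fact+
  then have "sin \<theta> = sin \<theta>' \<and> cos \<theta> = cos \<theta>'"
    using eqs(1,2) unfolding r by simp
  then obtain m :: int where m: "\<theta> = \<theta>' + 2 * pi * m"
    unfolding sin_cos_eq_iff by blast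
  have "\<bar>2 * pi * real_of_int m\<bar> < 2 * pi * 1"
    using \<open>\<bar>\<theta> - \<theta>'\<bar> < 2 * pi\<close> unfolding m by simp
  then have "\<bar>real_of_int m\<bar> < 1"
    by (simp add: abs_mult)
  then have "m = 0"
    by linarith
  then show "r = r' \<and> \<theta> = \<theta>'"
    using m r by simp
qed

lemma range_inv_stereo:
  assumes "\<bar>s\<bar> = 1"
  shows "range (inv_stereo s :: 'e::euclidean_space \<Rightarrow> 'e \<times> real) = sphere 0 1 - {(0, - s)}"
    and "inj (inv_stereo s :: 'e \<Rightarrow> 'e \<times> real)"
proof -
  have s: "s = 1 \<or> s = -1"
    using assms by linarith
  then have ss: "s * s = 1"
    by auto
  define \<pi> where "\<pi> = (\<lambda>p :: 'e \<times> real. (1 / (1 + s * snd p)) *\<^sub>R fst p)"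
  have pos: "1 + (norm y)\<^sup>2 > 0" for y :: 'e
    by (simp add: add_pos_nonneg)
  have left: "\<pi> (inv_stereo s y) = y" for y :: 'e
  proof -
    define q where "q = 1 + (norm y)\<^sup>2"
    have q: "q > 0" using pos [of y] by (simp add: q_def)
    have "1 + s * (s * ((2 - q) / q)) = 1 + (s * s) * ((2 - q) / q)"
      by (simp only: mult.assoc)
    also have "\<dots> = 2 / q"
      unfolding ss using q by (simp add: field_simps)
    finally have eq: "1 + s * (s * ((2 - q) / q)) = 2 / q" .
    have "inv_stereo s y = ((2 / q) *\<^sub>R y, s * ((2 - q) / q))"
      by (simp add: inv_stereo_def q_def)
    then have "\<pi> (inv_stereo s y) = (1 / (1 + s * (s * ((2 - q) / q)))) *\<^sub>R ((2 / q) *\<^sub>R y)"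
      by (simp only: \<pi>_def fst_conv snd_conv)
    then show ?thesis
      unfolding eq using q by simp
  qed
  then show "inj (inv_stereo s :: 'e \<Rightarrow> 'e \<times> real)"
    by (intro inj_on_inverseI [where g = \<pi>]) (rule left)
  have sub: "inv_stereo s y \<in> sphere 0 1 - {(0, - s)}" for y :: 'e
  proof -
    define q where "q = (norm y)\<^sup>2"
    have q: "1 + q > 0" using pos [of y] by (simp add: q_def)
    have "(norm (inv_stereo s y))\<^sup>2 = (2 / (1 + q))\<^sup>2 * q + (s * s) * ((1 - q) / (1 + q))\<^sup>2"
      by (simp add: inv_stereo_def norm_Pair q_def power_mult_distrib power2_eq_square)
    also have "\<dots> = (4 * q + (1 - q)\<^sup>2) / (1 + q)\<^sup>2"
      by (simp add: ss power_divide add_divide_distrib)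
    also have "4 * q + (1 - q)\<^sup>2 = (1 + q)\<^sup>2"
      by (simp add: power2_eq_square algebra_simps)
    finally have "(norm (inv_stereo s y))\<^sup>2 = 1"
      using q by simp
    then have "norm (inv_stereo s y) = 1"
      using power2_eq_iff_nonneg [of "norm (inv_stereo s y)" 1] by simp
    moreover have "inv_stereo s y \<noteq> (0, - s)"
    proof
      assume eq: "inv_stereo s y = (0, - s)"
      have "\<pi> (inv_stereo s y) = 0" by (simp only: eq) (simp add: \<pi>_def)
      then have "y = 0" by (simp add: left)
      then have "s = - s" using eq by (simp add: inv_stereo_def)
      then show False using assms by simp
    qed
    ultimately show ?thesis by simp
  qed
  have "p \<in> range (inv_stereo s)" if p: "p \<in> sphere 0 1 - {(0, - s)}" for p :: "'e \<times> real"
  proof -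
    obtain z t where pz: "p = (z, t)" by force
    have "(norm p)\<^sup>2 = 1" using p by simp
    then have zt: "(norm z)\<^sup>2 + t\<^sup>2 = 1" by (simp add: pz norm_Pair)
    define c where "c = 1 + s * t"
    have z2: "(norm z)\<^sup>2 = c * (2 - c)"
    proof -
      have "(norm z)\<^sup>2 = 1 - t\<^sup>2" using zt by linarith
      also have "\<dots> = c * (2 - c)" using ss unfolding c_def by algebra
      finally show ?thesis .
    qed
    have c0: "c \<noteq> 0"
    proof
      assume "c = 0"
      then have "z = 0" using z2 by simp
      moreover have "t = - s"
        using \<open>c = 0\<close> s unfolding c_def by auto
      ultimately show False using p by (simp add: pz)
    qed
    have n: "(norm (\<pi> p))\<^sup>2 = (2 - c) / c"
    proof -
      have "\<pi> p = (1 / c) *\<^sub>R z"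
        by (simp add: \<pi>_def pz c_def)
      then have "(norm (\<pi> p))\<^sup>2 = (norm z)\<^sup>2 / c\<^sup>2"
        by (simp add: power_mult_distrib power_divide)
      then have "(norm (\<pi> p))\<^sup>2 = c * (2 - c) / c\<^sup>2" by (simp only: z2)
      then show ?thesis using c0 by (simp only: power2_eq_square) simp
    qed
    have n1: "1 + (norm (\<pi> p))\<^sup>2 = 2 / c" and n2: "1 - (norm (\<pi> p))\<^sup>2 = 2 * (c - 1) / c"
      unfolding n using c0 by (simp_all add: diff_divide_distrib)
    have pip: "\<pi> p = (1 / c) *\<^sub>R z"
      by (simp add: \<pi>_def pz c_def)
    have c1: "s * (c - 1) = t"
      using s by (auto simp: c_def)
    have "(2 / (2 / c)) *\<^sub>R ((1 / c) *\<^sub>R z) = z" "(2 * (c - 1) / c) / (2 / c) = c - 1"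
      using c0 by simp_all
    then have "inv_stereo s (\<pi> p) = (z, t)"
      unfolding inv_stereo_def n1 n2 by (simp only: pip c1)
    then have "p = inv_stereo s (\<pi> p)"
      by (simp only: pz)
    then show ?thesis by (rule range_eqI)
  qed
  then show "range (inv_stereo s :: 'e \<Rightarrow> 'e \<times> real) = sphere 0 1 - {(0, - s)}"
    by (intro subset_antisym image_subsetI subsetI sub)
qed

end

theory Submission
  imports Defs
begin

text \<open>
  All four maps have the form \<open>(r, \<theta>) \<mapsto> (\<rho> r, \<kappa> \<theta>)\<close> in polar coordinates. Let \<open>e\<^sub>\<rho>\<close> be the unit
  vector field of the target along the meridians. Then the tension field with respect to
  \<open>g\<^sub>0\<close> is \<open>T e\<^sub>\<rho>\<close> with

    \<open>T = \<rho>'' + cot r \<rho>' - \<kappa>\<^sup>2 sin \<rho> cos \<rho> / sin\<^sup>2 r\<close>,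

  and the Jacobi operator of the map takes \<open>F e\<^sub>\<rho>\<close> to \<open>L F e\<^sub>\<rho>\<close>, where

    \<open>L F = F'' + cot r F' - \<kappa>\<^sup>2 cos (2 \<rho>) F / sin\<^sup>2 r\<close>

  is the linearisation of \<open>T\<close> in \<open>\<rho>\<close>. In dimension two the metric \<open>f\<^sup>-\<^sup>1 g\<^sub>0\<close> multiplies the trace of
  the second fundamental form and the Jacobi operator by \<open>f\<close>. So the bitension field of the map
  from \<open>f\<^sup>-\<^sup>1 g\<^sub>0\<close> is \<open>f L (f T) e\<^sub>\<rho>\<close>, and by the product rule \<open>L (f T) = 0\<close> is also the
  equation of an \<open>f\<close>-biharmonic map from \<open>g\<^sub>0\<close>. The single ordinary differential equation
  \<open>L (f T) = 0\<close> therefore gives both statements (\<open>tension_frame\<close>, \<open>bitension_frame\<close>,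
  \<open>jacobi_mult\<close>).

  The target enters only through two orthonormal vectors \<open>e1\<close>, \<open>e2\<close> that span the plane of
  the angular coordinate: the computation is made in the stereographic charts of a unit sphere of
  arbitrary dimension. This treats the maps into the 2-sphere and their compositions with the
  great sphere embedding at the same time. In a chart the pull-back connection is computed in the
  orthonormal frame of meridian and latitude directions (\<open>pullback_connection_frame\<close>), where it
  has the same form in both charts.

  The derivation \<open>sin r d/dr\<close> turns the equation into \<open>F_ss = \<kappa>\<^sup>2 cos (2 \<rho>) F\<close> on a flat cylinder
  (\<open>f_biharmonic_criterion\<close>). For the four maps the function \<open>f T\<close> is elementary:
  \<open>- 2 / cos\<^sup>2 (r / 2)\<close> for the first one; up to sign and constants, \<open>tan\<^sup>c (r / 2)\<close> times a
  quadratic polynomial in \<open>cos r\<close>, \<open>c = \<plusminus> sqrt 3\<close>, for the second and the third; and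
  \<open>sin (sqrt 3 r / 2) / sqrt (sin r)\<close> for the last one. None of these functions vanishes
  identically, so the maps are not harmonic. Weak conformality would mean
  \<open>(sin r \<rho>')\<^sup>2 = \<kappa>\<^sup>2 sin\<^sup>2 \<rho>\<close>, which fails in each case.
\<close>


section \<open>Calculus of smooth functions\<close>

lemma frechet_derivative_cong_open:
  assumes "open U" "x \<in> U" "\<And>y. y \<in> U \<Longrightarrow> F y = G y" "(G has_derivative D) (at x)"
  shows "frechet_derivative F (at x) = D"
  using has_derivative_transform_within_open[OF assms(4,1,2)] assms(3)
  by (metis frechet_derivative_at)

lemma Ck_on_SucI:
  assumes "open U" "\<And>x. x \<in> U \<Longrightarrow> (F has_derivative D x) (at x)"
    and "\<And>u. Ck_on k U (\<lambda>x. frechet_derivative F (at x) u)"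
  shows "Ck_on (Suc k) U F"
  using assms by (auto simp: differentiable_def)

lemma Ck_on_cong:
  assumes "open U" "\<And>x. x \<in> U \<Longrightarrow> F x = G x" "Ck_on k U F"
  shows "Ck_on k U G"
  using assms(2,3)
proof (induction k arbitrary: F G)
  case 0
  then show ?case using continuous_on_cong[of U U F G] by simp
next
  case (Suc k)
  have D: "(G has_derivative frechet_derivative F (at x)) (at x)" if "x \<in> U" for x
  proof (rule has_derivative_transform_within_open[OF _ assms(1) that Suc.prems(1)])
    show "(F has_derivative frechet_derivative F (at x)) (at x)"
      using Suc.prems(2) that frechet_derivative_works by auto
  qed auto
  have "Ck_on k U (\<lambda>x. frechet_derivative G (at x) u)" for u
  proof (rule Suc.IH)
    show "frechet_derivative F (at x) u = frechet_derivative G (at x) u" if "x \<in> U" for x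
      using frechet_derivative_at[OF D[OF that]] by simp
    show "Ck_on k U (\<lambda>x. frechet_derivative F (at x) u)" using Suc.prems(2) by simp
  qed
  then show ?case using D by (auto simp: differentiable_def)
qed

lemma Ck_on_Suc_derivI:
  assumes "open U" "\<And>x. x \<in> U \<Longrightarrow> (F has_derivative D x) (at x)"
    and "\<And>u. Ck_on k U (\<lambda>x. D x u)"
  shows "Ck_on (Suc k) U F"
proof (rule Ck_on_SucI[OF assms(1,2)])
  fix u
  show "Ck_on k U (\<lambda>x. frechet_derivative F (at x) u)"
    by (rule Ck_on_cong[OF assms(1) _ assms(3)[of u]])
      (use frechet_derivative_at[OF assms(2)] in simp)
qed

lemma Ck_on_has_derivative:
  assumes "Ck_on (Suc k) U F" "x \<in> U"
  shows "(F has_derivative frechet_derivative F (at x)) (at x)"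
  using assms frechet_derivative_works by auto

lemma Ck_on_SucD: "Ck_on (Suc k) U F \<Longrightarrow> Ck_on k U F"
proof (induction k arbitrary: F)
  case 0
  then show ?case
    by (auto intro!: continuous_at_imp_continuous_on differentiable_imp_continuous_within)
next
  case (Suc k)
  have "Ck_on (Suc k) U (\<lambda>x. frechet_derivative F (at x) u)" for u
    using Suc.prems by (subst (asm) Ck_on.simps(2)) blast
  then have "Ck_on k U (\<lambda>x. frechet_derivative F (at x) u)" for u
    by (rule Suc.IH)
  moreover have "\<forall>x\<in>U. F differentiable at x"
    using Suc.prems by (subst (asm) Ck_on.simps(2)) blast
  ultimately show ?case by simp
qed

lemma Ck_on_const: "Ck_on k U (\<lambda>_. c)"
proof (induction k arbitrary: c)
  case (Suc k)
  have "frechet_derivative (\<lambda>_. c) (at x) = (\<lambda>_. 0)" for x :: 'a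
    by (rule frechet_derivative_at[symmetric]) simp
  then show ?case using Suc by simp
qed simp

lemma Ck_on_linear:
  assumes "bounded_linear L" "open U"
  shows "Ck_on k U L"
proof (cases k)
  case 0
  then show ?thesis using assms(1) by (simp add: linear_continuous_on)
next
  case (Suc m)
  show ?thesis
    unfolding Suc
    by (rule Ck_on_Suc_derivI[OF assms(2), where D = "\<lambda>_. L"])
      (auto intro: bounded_linear_imp_has_derivative assms Ck_on_const)
qed

lemma Ck_on_add:
  assumes "open U" "Ck_on k U F" "Ck_on k U G"
  shows "Ck_on k U (\<lambda>x. F x + G x)"
  using assms(2,3)
proof (induction k arbitrary: F G)
  case 0
  then show ?case by (simp add: continuous_on_add)
next
  case (Suc k)
  show ?case
    by (rule Ck_on_Suc_derivI[OF assms(1)],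
        rule has_derivative_add[OF Ck_on_has_derivative[OF Suc.prems(1)] Ck_on_has_derivative[OF Suc.prems(2)]])
      (use Suc in auto)
qed

lemma Ck_on_sum:
  assumes "open U" "finite A" "\<And>a. a \<in> A \<Longrightarrow> Ck_on k U (F a)"
  shows "Ck_on k U (\<lambda>x. \<Sum>a\<in>A. F a x)"
  using assms(2,3) by (induction A) (auto intro: Ck_on_add assms(1) Ck_on_const)

lemma Ck_on_bilinear:
  assumes "open U" "bounded_bilinear B" "Ck_on k U F" "Ck_on k U G"
  shows "Ck_on k U (\<lambda>x. B (F x) (G x))"
  using assms(3,4)
proof (induction k arbitrary: F G)
  case 0
  then show ?case by (simp add: bounded_bilinear.continuous_on[OF assms(2)])
next
  case (Suc k)
  show ?case
    by (rule Ck_on_Suc_derivI[OF assms(1)],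
        rule bounded_bilinear.FDERIV[OF assms(2) Ck_on_has_derivative[OF Suc.prems(1)]
          Ck_on_has_derivative[OF Suc.prems(2)]])
      (use Suc Ck_on_SucD[OF Suc.prems(1)] Ck_on_SucD[OF Suc.prems(2)]
        in \<open>auto intro!: Ck_on_add assms(1)\<close>)
qed

text \<open>The chain rule is written in a basis of the middle space, so that the derivative of the
  composite is a sum of products to which the induction hypothesis applies.\<close>

lemma Ck_on_compose:
  fixes F :: "'b::euclidean_space \<Rightarrow> 'c::real_normed_vector" and G :: "'a::euclidean_space \<Rightarrow> 'b"
  assumes "open U" "Ck_on k V F" "Ck_on k U G" "\<And>x. x \<in> U \<Longrightarrow> G x \<in> V"
  shows "Ck_on k U (\<lambda>x. F (G x))"
  using assms(2,3)
proof (induction k arbitrary: F)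
  case 0
  then show ?case using continuous_on_compose2[of V F U G] assms(4) by auto
next
  case (Suc k)
  let ?DF = "\<lambda>y. frechet_derivative F (at y)" and ?DG = "\<lambda>x. frechet_derivative G (at x)"
  have "((\<lambda>x. F (G x)) has_derivative (\<lambda>u. ?DF (G x) (?DG x u))) (at x)" if "x \<in> U" for x
    by (rule has_derivative_compose[OF Ck_on_has_derivative[OF Suc.prems(2) that]
          Ck_on_has_derivative[OF Suc.prems(1) assms(4)[OF that]]])
  moreover have "Ck_on k U (\<lambda>x. ?DF (G x) (?DG x u))" for u
  proof (rule Ck_on_cong[OF assms(1)])
    fix x assume x: "x \<in> U"
    have lin: "linear (?DF (G x))"
      using Ck_on_has_derivative[OF Suc.prems(1) assms(4)[OF x]] has_derivative_linear by blast
    have "?DF (G x) (?DG x u) = ?DF (G x) (\<Sum>b\<in>Basis. (?DG x u \<bullet> b) *\<^sub>R b)"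
      by (simp only: euclidean_representation)
    then show "(\<Sum>b\<in>Basis. (?DG x u \<bullet> b) *\<^sub>R ?DF (G x) b) = ?DF (G x) (?DG x u)"
      by (simp add: linear_sum[OF lin] linear_scale[OF lin])
  next
    have "Ck_on k U (\<lambda>x. ?DF (G x) b)" for b
      using Suc.prems Ck_on_SucD[OF Suc.prems(2)] by (intro Suc.IH) auto
    moreover have "Ck_on k U (\<lambda>x. ?DG x u)" using Suc.prems by simp
    ultimately show "Ck_on k U (\<lambda>x. \<Sum>b\<in>Basis. (?DG x u \<bullet> b) *\<^sub>R ?DF (G x) b)"
      by (auto intro!: Ck_on_sum assms(1) Ck_on_bilinear[OF assms(1) bounded_bilinear_scaleR]
          Ck_on_bilinear[OF assms(1) bounded_bilinear_inner] Ck_on_const)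
  qed
  ultimately show ?case by (intro Ck_on_Suc_derivI[OF assms(1)])
qed

lemma Ck_on_real_SucI:
  fixes f f' :: "real \<Rightarrow> real"
  assumes "open S" "\<And>x. x \<in> S \<Longrightarrow> (f has_real_derivative f' x) (at x)" "Ck_on k S f'"
  shows "Ck_on (Suc k) S f"
  by (rule Ck_on_Suc_derivI[OF assms(1) assms(2)[unfolded has_field_derivative_def]])
    (auto intro!: Ck_on_bilinear[OF assms(1) bounded_bilinear_mult] assms(3) Ck_on_const)

lemma smooth_on_cong:
  "smooth_on U F \<Longrightarrow> open U \<Longrightarrow> (\<And>x. x \<in> U \<Longrightarrow> F x = G x) \<Longrightarrow> smooth_on U G"
  unfolding smooth_on_def using Ck_on_cong by blast

lemma smooth_on_imp_continuous_on: "smooth_on U F \<Longrightarrow> continuous_on U F"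
  unfolding smooth_on_def using Ck_on.simps(1) by blast

lemma smooth_on_const: "smooth_on U (\<lambda>_. c)"
  by (simp add: smooth_on_def Ck_on_const)

lemma smooth_on_linear: "bounded_linear L \<Longrightarrow> open U \<Longrightarrow> smooth_on U L"
  by (simp add: smooth_on_def Ck_on_linear)

lemma smooth_on_add: "open U \<Longrightarrow> smooth_on U F \<Longrightarrow> smooth_on U G \<Longrightarrow> smooth_on U (\<lambda>x. F x + G x)"
  by (simp add: smooth_on_def Ck_on_add)

lemma smooth_on_bilinear:
  "bounded_bilinear B \<Longrightarrow> open U \<Longrightarrow> smooth_on U F \<Longrightarrow> smooth_on U G \<Longrightarrow> smooth_on U (\<lambda>x. B (F x) (G x))"
  by (simp add: smooth_on_def Ck_on_bilinear)

lemmas smooth_on_mult = smooth_on_bilinear[OF bounded_bilinear_mult]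
lemmas smooth_on_scaleR = smooth_on_bilinear[OF bounded_bilinear_scaleR]
lemmas smooth_on_inner = smooth_on_bilinear[OF bounded_bilinear_inner]

lemma smooth_on_compose:
  fixes F :: "'b::euclidean_space \<Rightarrow> 'c::real_normed_vector" and G :: "'a::euclidean_space \<Rightarrow> 'b"
  assumes "smooth_on V F" "open U" "smooth_on U G" "\<And>x. x \<in> U \<Longrightarrow> G x \<in> V"
  shows "smooth_on U (\<lambda>x. F (G x))"
  using assms unfolding smooth_on_def by (blast intro: Ck_on_compose)

lemma smooth_on_minus:
  fixes F :: "'a::euclidean_space \<Rightarrow> 'b::euclidean_space"
  assumes "open U" "smooth_on U F"
  shows "smooth_on U (\<lambda>x. - F x)"
  using smooth_on_scaleR[OF assms(1) smooth_on_const[of U "-1"] assms(2)] by simp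

lemma smooth_on_diff:
  fixes F G :: "'a::euclidean_space \<Rightarrow> 'b::euclidean_space"
  assumes "open U" "smooth_on U F" "smooth_on U G"
  shows "smooth_on U (\<lambda>x. F x - G x)"
  using smooth_on_add[OF assms(1,2) smooth_on_minus[OF assms(1,3)]] by simp

lemma smooth_on_power:
  fixes F :: "'a::euclidean_space \<Rightarrow> real"
  assumes "open U" "smooth_on U F"
  shows "smooth_on U (\<lambda>x. F x ^ n)"
  by (induction n) (auto intro!: smooth_on_const smooth_on_mult assms)

text \<open>Sine and cosine are each other's derivatives up to sign, so one induction treats both. For the
  reciprocal and for powers, the derivative is an expression in functions of the same family.\<close>

lemma smooth_on_real_sin_cos: "smooth_on UNIV (sin :: real \<Rightarrow> real) \<and> smooth_on UNIV (cos :: real \<Rightarrow> real)"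
proof -
  have "Ck_on k UNIV (sin :: real \<Rightarrow> real) \<and> Ck_on k UNIV (cos :: real \<Rightarrow> real)" for k
  proof (induction k)
    case 0
    then show ?case by (auto intro!: continuous_intros)
  next
    case (Suc k)
    have "Ck_on k UNIV (\<lambda>x::real. (-1) * sin x)"
      by (rule Ck_on_bilinear[OF _ bounded_bilinear_mult Ck_on_const]) (use Suc in auto)
    then show ?case
      using Suc
      by (intro conjI; intro Ck_on_real_SucI[where f' = cos] Ck_on_real_SucI[where f' = "\<lambda>x. - sin x"])
        (auto intro!: derivative_eq_intros)
  qed
  then show ?thesis by (simp add: smooth_on_def)
qed

lemma smooth_on_real_inverse: "smooth_on {x::real. x \<noteq> 0} inverse"
proof -
  have o: "open {x::real. x \<noteq> 0}" by (simp add: open_Collect_neq continuous_on_id)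
  have "Ck_on k {x::real. x \<noteq> 0} inverse" for k
  proof (induction k)
    case 0
    then show ?case by (auto intro!: continuous_intros)
  next
    case (Suc k)
    have "Ck_on k {x::real. x \<noteq> 0} (\<lambda>x. (-1) * (inverse x * inverse x))"
      by (intro Ck_on_bilinear[OF o bounded_bilinear_mult] Ck_on_const Suc)
    then show ?case
      by (rule Ck_on_real_SucI[OF o, rotated]) (auto intro!: derivative_eq_intros)
  qed
  then show ?thesis by (simp add: smooth_on_def)
qed

lemma smooth_on_real_powr: "smooth_on {0<..} (\<lambda>x::real. x powr c)"
proof -
  have "Ck_on k {0<..} (\<lambda>x::real. x powr c)" for k
  proof (induction k arbitrary: c)
    case 0
    then show ?case by (auto intro!: continuous_intros)
  next
    case (Suc k)
    have "Ck_on k {0<..} (\<lambda>x::real. c * x powr (c - 1))"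
      by (intro Ck_on_bilinear[OF open_greaterThan bounded_bilinear_mult] Ck_on_const Suc)
    then show ?case
      by (rule Ck_on_real_SucI[OF open_greaterThan, rotated]) (auto intro!: derivative_eq_intros)
  qed
  then show ?thesis by (simp add: smooth_on_def)
qed

lemma smooth_on_sin:
  fixes F :: "'a::euclidean_space \<Rightarrow> real"
  shows "open U \<Longrightarrow> smooth_on U F \<Longrightarrow> smooth_on U (\<lambda>x. sin (F x))"
  using smooth_on_compose[OF conjunct1[OF smooth_on_real_sin_cos]] by simp

lemma smooth_on_cos:
  fixes F :: "'a::euclidean_space \<Rightarrow> real"
  shows "open U \<Longrightarrow> smooth_on U F \<Longrightarrow> smooth_on U (\<lambda>x. cos (F x))"
  using smooth_on_compose[OF conjunct2[OF smooth_on_real_sin_cos]] by simp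

lemma smooth_on_inverse:
  fixes F :: "'a::euclidean_space \<Rightarrow> real"
  shows "open U \<Longrightarrow> smooth_on U F \<Longrightarrow> (\<And>x. x \<in> U \<Longrightarrow> F x \<noteq> 0) \<Longrightarrow> smooth_on U (\<lambda>x. inverse (F x))"
  by (rule smooth_on_compose[OF smooth_on_real_inverse]) auto

lemma smooth_on_divide:
  fixes F G :: "'a::euclidean_space \<Rightarrow> real"
  shows "open U \<Longrightarrow> smooth_on U F \<Longrightarrow> smooth_on U G \<Longrightarrow> (\<And>x. x \<in> U \<Longrightarrow> G x \<noteq> 0) \<Longrightarrow> smooth_on U (\<lambda>x. F x / G x)"
  unfolding divide_inverse by (intro smooth_on_mult smooth_on_inverse)

lemma smooth_on_powr:
  fixes F :: "'a::euclidean_space \<Rightarrow> real"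
  shows "open U \<Longrightarrow> smooth_on U F \<Longrightarrow> (\<And>x. x \<in> U \<Longrightarrow> F x > 0) \<Longrightarrow> smooth_on U (\<lambda>x. F x powr c)"
  by (rule smooth_on_compose[OF smooth_on_real_powr]) auto

lemma smooth_on_sqrt:
  fixes F :: "'a::euclidean_space \<Rightarrow> real"
  assumes "open U" "smooth_on U F" "\<And>x. x \<in> U \<Longrightarrow> F x > 0"
  shows "smooth_on U (\<lambda>x. sqrt (F x))"
  by (rule smooth_on_cong[OF smooth_on_powr[OF assms, where c = "1/2"] assms(1)])
    (use assms(3) in \<open>auto simp: powr_half_sqrt less_imp_le\<close>)

text \<open>Away from zeros the absolute value is the square root of a positive smooth function.\<close>

lemma smooth_on_abs:
  fixes F :: "'a::euclidean_space \<Rightarrow> real"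
  assumes "open U" "smooth_on U F" "\<And>x. x \<in> U \<Longrightarrow> F x \<noteq> 0"
  shows "smooth_on U (\<lambda>x. \<bar>F x\<bar>)"
  by (rule smooth_on_cong[OF smooth_on_sqrt[where F = "\<lambda>x. F x ^ 2"] assms(1)])
    (use assms in \<open>auto intro: smooth_on_power\<close>)

lemma smooth_on_tan:
  fixes F :: "'a::euclidean_space \<Rightarrow> real"
  shows "open U \<Longrightarrow> smooth_on U F \<Longrightarrow> (\<And>x. x \<in> U \<Longrightarrow> cos (F x) \<noteq> 0) \<Longrightarrow> smooth_on U (\<lambda>x. tan (F x))"
  unfolding tan_def by (intro smooth_on_divide smooth_on_sin smooth_on_cos)

lemma smooth_on_cot:
  fixes F :: "'a::euclidean_space \<Rightarrow> real"
  shows "open U \<Longrightarrow> smooth_on U F \<Longrightarrow> (\<And>x. x \<in> U \<Longrightarrow> sin (F x) \<noteq> 0) \<Longrightarrow> smooth_on U (\<lambda>x. cot (F x))"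
  unfolding cot_def by (intro smooth_on_divide smooth_on_sin smooth_on_cos)

lemma smooth_on_id: "open U \<Longrightarrow> smooth_on U (\<lambda>x. x)"
  by (rule smooth_on_linear[OF bounded_linear_ident])

lemmas smooth_intros =
  smooth_on_const smooth_on_id smooth_on_add smooth_on_diff smooth_on_minus smooth_on_mult
  smooth_on_scaleR smooth_on_inner smooth_on_power smooth_on_inverse smooth_on_divide
  smooth_on_sin smooth_on_cos smooth_on_tan smooth_on_cot smooth_on_powr smooth_on_sqrt smooth_on_abs

lemma smooth_on_realI:
  fixes f f' :: "real \<Rightarrow> real"
  assumes "open S" "\<And>x. x \<in> S \<Longrightarrow> (f has_real_derivative f' x) (at x)" "smooth_on S f'"
  shows "smooth_on S f"
  unfolding smooth_on_def
proof
  fix k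
  show "Ck_on k S f"
    using Ck_on_SucD Ck_on_real_SucI[OF assms(1,2)] assms(3) unfolding smooth_on_def by blast
qed

lemma smooth_on_arccos:
  fixes F :: "'a::euclidean_space \<Rightarrow> real"
  assumes "open U" "smooth_on U F" "\<And>x. x \<in> U \<Longrightarrow> \<bar>F x\<bar> < 1"
  shows "smooth_on U (\<lambda>x. arccos (F x))"
proof (rule smooth_on_compose[OF _ assms(1,2)])
  have pos: "1 - x\<^sup>2 > 0" if "x \<in> {-1<..<1}" for x :: real
    using that abs_square_less_1[of x] by auto
  show "smooth_on {-1<..<1} arccos"
  proof (rule smooth_on_realI)
    show "(arccos has_real_derivative inverse (- sqrt (1 - x\<^sup>2))) (at x)" if "x \<in> {-1<..<1}" for x
      using that DERIV_arccos by simp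
    show "smooth_on {-1<..<1} (\<lambda>x::real. inverse (- sqrt (1 - x\<^sup>2)))"
      by (intro smooth_intros pos open_greaterThanLessThan) (use pos in fastforce)+
  qed simp
qed (use assms(3) in force)

lemma smooth_on_real_derivative:
  fixes f :: "real \<Rightarrow> real"
  assumes "open S" "smooth_on S f"
  shows "x \<in> S \<Longrightarrow> (f has_real_derivative deriv f x) (at x)" and "smooth_on S (deriv f)"
proof -
  have D: "(f has_real_derivative frechet_derivative f (at x) 1) (at x)" if "x \<in> S" for x
  proof -
    have *: "(f has_derivative frechet_derivative f (at x)) (at x)"
      using assms(2) that Ck_on_has_derivative unfolding smooth_on_def by blast
    have "frechet_derivative f (at x) u = frechet_derivative f (at x) 1 * u" for u
      using linear_scale[OF has_derivative_linear[OF *], of u 1] by (simp add: mult.commute)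
    then have "frechet_derivative f (at x) = (*) (frechet_derivative f (at x) 1)"
      by (rule ext)
    then show ?thesis using * by (simp add: has_field_derivative_def)
  qed
  then show "x \<in> S \<Longrightarrow> (f has_real_derivative deriv f x) (at x)"
    using DERIV_imp_deriv by metis
  have "smooth_on S (\<lambda>x. frechet_derivative f (at x) 1)"
    using assms(2) unfolding smooth_on_def by (metis Ck_on.simps(2))
  then show "smooth_on S (deriv f)"
    by (rule smooth_on_cong[OF _ assms(1)]) (use D DERIV_imp_deriv in metis)
qed

section \<open>The round metric in a stereographic chart\<close>

definition stereo_factor :: "'e::euclidean_space \<Rightarrow> real" where
  "stereo_factor y = 2 / (1 + y \<bullet> y)"

lemma stereo_factor_pos: "stereo_factor y > 0"
  by (simp add: stereo_factor_def add_pos_nonneg)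

lemma stereo_factor_eq: "stereo_factor y * (1 + y \<bullet> y) = 2"
proof -
  have "1 + y \<bullet> y > 0" by (simp add: add_pos_nonneg)
  then show ?thesis unfolding stereo_factor_def by (metis less_irrefl nonzero_eq_divide_eq)
qed

lemma has_derivative_stereo_factor:
  "(stereo_factor has_derivative (\<lambda>u. - (stereo_factor y)\<^sup>2 * (y \<bullet> u))) (at y)"
proof -
  have pos: "1 + y \<bullet> y > 0" by (simp add: add_pos_nonneg)
  have inner: "((\<lambda>y. 1 + y \<bullet> y) has_derivative (\<lambda>u. 2 * (y \<bullet> u))) (at y)"
    by (auto intro!: derivative_eq_intros simp: fun_eq_iff inner_commute)
  have "((\<lambda>t. 2 / t) has_real_derivative - (2 / (1 + y \<bullet> y)\<^sup>2)) (at (1 + y \<bullet> y))"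
    using pos by (auto intro!: derivative_eq_intros simp: power2_eq_square)
  from has_derivative_compose[OF inner this[unfolded has_field_derivative_def]]
  show ?thesis
    by (simp add: stereo_factor_def[abs_def] power_divide power2_eq_square mult_ac)
qed

lemma smooth_on_stereo_factor: "smooth_on UNIV stereo_factor"
  unfolding stereo_factor_def[abs_def]
  by (intro smooth_intros open_UNIV) (metis add_pos_nonneg inner_ge_zero less_irrefl zero_less_one)

lemma inv_stereo_eq: "inv_stereo s y = (stereo_factor y *\<^sub>R y, s * (stereo_factor y - 1))"
proof -
  have "1 + (norm y)\<^sup>2 > 0" by (simp add: add_pos_nonneg)
  then show ?thesis
    by (simp add: inv_stereo_def stereo_factor_def power2_norm_eq_inner[symmetric] field_simps)
qed

text \<open>The inverse stereographic projection is conformal. The radial contributions to the inner product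
  cancel because of \<open>stereo_factor_eq\<close>.\<close>

lemma induced_metric_inv_stereo:
  assumes "\<bar>s\<bar> = 1"
  shows "induced_metric (inv_stereo s :: 'e::euclidean_space \<Rightarrow> 'e \<times> real) = (\<lambda>y u v. (stereo_factor y)\<^sup>2 * (u \<bullet> v))"
proof (intro ext)
  fix y u v :: 'e
  let ?c = "stereo_factor y"
  define D where "D = (\<lambda>u. (?c *\<^sub>R u + (- ?c\<^sup>2 * (y \<bullet> u)) *\<^sub>R y, s * (- ?c\<^sup>2 * (y \<bullet> u))))"
  have "inv_stereo s = (\<lambda>y::'e. (stereo_factor y *\<^sub>R y, s * (stereo_factor y - 1)))"
    by (rule ext) (rule inv_stereo_eq)
  moreover have "((\<lambda>y. (stereo_factor y *\<^sub>R y, s * (stereo_factor y - 1))) has_derivative D) (at y)"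
    unfolding D_def
    by (rule derivative_eq_intros has_derivative_stereo_factor refl)+ (auto simp: fun_eq_iff)
  ultimately have "frechet_derivative (inv_stereo s) (at y) = D"
    using frechet_derivative_at by metis
  then have "induced_metric (inv_stereo s) y u v = D u \<bullet> D v"
    by (simp add: induced_metric_def)
  also have "\<dots> = ?c\<^sup>2 * (u \<bullet> v)"
  proof -
    have "s * s = 1" using assms by (metis abs_mult_self_eq mult_1)
    moreover have "D u \<bullet> D v = ?c\<^sup>2 * (u \<bullet> v) - 2 * ?c^3 * (y \<bullet> u) * (y \<bullet> v)
        + ?c^4 * (y \<bullet> u) * (y \<bullet> v) * (y \<bullet> y) + (s * s) * ?c^4 * (y \<bullet> u) * (y \<bullet> v)"
      by (simp add: D_def inner_add_left inner_add_right inner_commute power2_eq_square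
          power3_eq_cube power4_eq_xxxx algebra_simps)
    ultimately show ?thesis using stereo_factor_eq[of y] by algebra
  qed
  finally show "induced_metric (inv_stereo s) y u v = ?c\<^sup>2 * (u \<bullet> v)" .
qed

lemma riemannian_metric_stereo:
  assumes "\<bar>s\<bar> = 1"
  shows "riemannian_metric_on UNIV (induced_metric (inv_stereo s :: 'e::euclidean_space \<Rightarrow> 'e \<times> real))"
proof -
  have "bilinear (\<lambda>u v :: 'e. (stereo_factor y)\<^sup>2 * (u \<bullet> v))" for y :: 'e
    by (auto simp: bilinear_def inner_add_left inner_add_right algebra_simps intro!: linearI)
  moreover have "(stereo_factor y)\<^sup>2 * (u \<bullet> u) > 0" if "u \<noteq> 0" for y u :: 'e
    using that stereo_factor_pos[of y] by simp
  moreover have "smooth_on UNIV (\<lambda>y::'e. (stereo_factor y)\<^sup>2 * (u \<bullet> v))" for u v :: 'e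
    by (intro smooth_intros smooth_on_stereo_factor open_UNIV)
  ultimately show ?thesis
    by (simp add: riemannian_metric_on_def induced_metric_inv_stereo[OF assms] inner_commute)
qed

lemma sharp_eqI:
  assumes "\<And>z. g x w z = \<alpha> z" "\<And>w'. (\<And>z. g x w' z = g x w z) \<Longrightarrow> w' = w"
  shows "sharp g x \<alpha> = w"
  unfolding sharp_def by (rule the_equality) (use assms in auto)

lemma sharp_stereo:
  assumes "\<bar>s\<bar> = 1"
  shows "sharp (induced_metric (inv_stereo s)) y (\<lambda>z. (stereo_factor y)\<^sup>2 * (w \<bullet> z)) = w"
proof (rule sharp_eqI)
  fix w' assume *: "\<And>z. induced_metric (inv_stereo s) y w' z = induced_metric (inv_stereo s) y w z"
  have "w' \<bullet> z = w \<bullet> z" for z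
    using *[of z] stereo_factor_pos[of y] by (simp add: induced_metric_inv_stereo[OF assms])
  then show "w' = w" using vector_eq_rdot by blast
qed (simp add: induced_metric_inv_stereo[OF assms])

text \<open>The Christoffel form of a metric \<open>c\<^sup>2 \<langle>\<cdot>, \<cdot>\<rangle>\<close> is governed by the gradient of \<open>ln c\<close>, which for the
  stereographic factor is \<open>- c y\<close>.\<close>

lemma christoffel_stereo:
  assumes "\<bar>s\<bar> = 1"
  shows "christoffel (induced_metric (inv_stereo s)) y u v
    = - stereo_factor y *\<^sub>R ((y \<bullet> u) *\<^sub>R v + (y \<bullet> v) *\<^sub>R u - (u \<bullet> v) *\<^sub>R y)" (is "_ = ?w")
proof -
  let ?c = "stereo_factor y"
  have D: "Dir (\<lambda>y. induced_metric (inv_stereo s) y v z) y u = - 2 * ?c^3 * (y \<bullet> u) * (v \<bullet> z)" for u v z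
  proof -
    have "((\<lambda>y. (stereo_factor y)\<^sup>2 * (v \<bullet> z)) has_derivative
        (\<lambda>u. - 2 * ?c^3 * (y \<bullet> u) * (v \<bullet> z))) (at y)"
      by (rule derivative_eq_intros has_derivative_stereo_factor refl)+
        (auto simp: fun_eq_iff power3_eq_cube power2_eq_square)
    then show ?thesis
      unfolding induced_metric_inv_stereo[OF assms] using frechet_derivative_at by metis
  qed
  have "(Dir (\<lambda>y. induced_metric (inv_stereo s) y v z) y u
      + Dir (\<lambda>y. induced_metric (inv_stereo s) y u z) y v
      - Dir (\<lambda>y. induced_metric (inv_stereo s) y u v) y z) / 2 = ?c\<^sup>2 * (?w \<bullet> z)" for z
    unfolding D
    by (simp add: inner_add_left inner_diff_left power2_eq_square power3_eq_cube field_simps)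
  then show ?thesis
    unfolding christoffel_def by (simp only: sharp_stereo[OF assms])
qed

text \<open>The sphere has constant curvature one. Since the Lie bracket of constant fields vanishes,
  only the derivatives and the iterates of the Christoffel form contribute.\<close>

lemma curvature_stereo:
  fixes y u v w :: "'e::euclidean_space"
  assumes "\<bar>s\<bar> = 1"
  shows "curvature (induced_metric (inv_stereo s)) y u v w
    = (stereo_factor y)\<^sup>2 *\<^sub>R ((v \<bullet> w) *\<^sub>R u - (u \<bullet> w) *\<^sub>R v)"
proof -
  let ?h = "induced_metric (inv_stereo s)"
  let ?c = "stereo_factor y"
  have const: "Dir (\<lambda>_::'e. a::'e) x = (\<lambda>_. 0)" for a x
    by (rule frechet_derivative_at[symmetric]) simp
  have lc: "levi_civita ?h (\<lambda>_. v) (\<lambda>_. w) = (\<lambda>y. christoffel ?h y v w)" for v w :: 'e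
    by (simp add: levi_civita_def fun_eq_iff const)
  have D: "Dir (\<lambda>y. christoffel ?h y v w) y u =
      ?c\<^sup>2 *\<^sub>R ((y \<bullet> u) *\<^sub>R ((y \<bullet> v) *\<^sub>R w + (y \<bullet> w) *\<^sub>R v - (v \<bullet> w) *\<^sub>R y))
      - ?c *\<^sub>R ((u \<bullet> v) *\<^sub>R w + (u \<bullet> w) *\<^sub>R v - (v \<bullet> w) *\<^sub>R u)" (is "_ = ?D v w u") for u v w
  proof -
    have "((\<lambda>y. - stereo_factor y *\<^sub>R ((y \<bullet> v) *\<^sub>R w + (y \<bullet> w) *\<^sub>R v - (v \<bullet> w) *\<^sub>R y))
      has_derivative ?D v w) (at y)"
      by (rule derivative_eq_intros has_derivative_stereo_factor refl)+
        (auto simp: fun_eq_iff algebra_simps)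
    then show ?thesis
      unfolding christoffel_stereo[OF assms] by (rule frechet_derivative_at[THEN fun_cong, symmetric])
  qed
  have "curvature ?h y u v w
      = ?D v w u + christoffel ?h y u (christoffel ?h y v w)
        - (?D u w v + christoffel ?h y v (christoffel ?h y u w))"
    unfolding curvature_def curvature_field_def lc
    by (simp only: levi_civita_def D lie_bracket_def const) (simp add: christoffel_stereo[OF assms])
  also have "\<dots> = ?c\<^sup>2 *\<^sub>R ((v \<bullet> w) *\<^sub>R u - (u \<bullet> w) *\<^sub>R v)" (is "?l = ?r")
  proof -
    \<comment> \<open>The two sides agree modulo the relation between \<open>y\<close> and the factor at \<open>y\<close>.\<close>
    have "?l \<bullet> z - ?r \<bullet> z
        = ?c * (2 - ?c * (1 + y \<bullet> y)) * ((v \<bullet> w) * (u \<bullet> z) - (u \<bullet> w) * (v \<bullet> z))" for z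
      unfolding christoffel_stereo[OF assms]
      by (simp add: inner_add_left inner_diff_left inner_add_right inner_diff_right inner_commute
          power2_eq_square algebra_simps)
    then have "?l \<bullet> z = ?r \<bullet> z" for z
      by (simp add: stereo_factor_eq)
    then show ?thesis using vector_eq_rdot by blast
  qed
  finally show ?thesis .
qed

section \<open>Metrics conformal to the round one in polar coordinates\<close>

text \<open>With \<open>f = 1\<close> this is the round metric itself, so that the two metrics of the
  problem are instances of one family.\<close>

definition polar_metric :: "(real \<Rightarrow> real) \<Rightarrow> (real \<times> real) metric" where
  "polar_metric f = conformal_metric (\<lambda>x. f (fst x)) g0"

lemma polar_metric_apply:
  "polar_metric f x u v = inverse (f (fst x)) * (fst u * fst v + (sin (fst x))\<^sup>2 * (snd u * snd v))"
  by (simp add: polar_metric_def conformal_metric_def g0_def)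

lemma polar_metric_1: "polar_metric (\<lambda>_. 1) = g0"
  by (simp add: polar_metric_apply g0_def fun_eq_iff)

lemma smooth_on_fst:
  fixes F :: "real \<Rightarrow> 'b::real_normed_vector"
  assumes "smooth_on I F" "open J"  "open I"
  shows "smooth_on (I \<times> J) (\<lambda>x::real \<times> real. F (fst x))"
  by (rule smooth_on_compose[OF assms(1)])
    (auto intro!: smooth_on_linear bounded_linear_fst open_Times assms)

lemma riemannian_polar_metric:
  assumes "open I" "I \<subseteq> {0<..<pi}" "open J" "smooth_on I f" "\<And>r. r \<in> I \<Longrightarrow> f r > 0"
  shows "riemannian_metric_on (I \<times> J) (polar_metric f)"
proof -
  have "bilinear (polar_metric f x)" for x
    by (auto simp: bilinear_def polar_metric_apply algebra_simps intro!: linearI)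
  moreover have "polar_metric f x u u > 0" if "x \<in> I \<times> J" "u \<noteq> 0" for x u
  proof -
    have "sin (fst x) > 0" "f (fst x) > 0"
      using that assms(2,5) by (auto intro!: sin_gt_zero)
    moreover have "fst u \<noteq> 0 \<or> snd u \<noteq> 0"
      using that by (auto simp: prod_eq_iff)
    ultimately have "(fst u)\<^sup>2 + (sin (fst x))\<^sup>2 * (snd u)\<^sup>2 > 0"
      by (metis add_nonneg_pos add_pos_nonneg mult_pos_pos zero_le_power2 zero_less_power2
          less_irrefl mult_nonneg_nonneg)
    then show ?thesis
      using \<open>f (fst x) > 0\<close> by (simp add: polar_metric_apply power2_eq_square)
  qed
  moreover have "smooth_on (I \<times> J) (\<lambda>x. polar_metric f x u v)" for u v
    unfolding polar_metric_apply
    by (intro smooth_intros smooth_on_fst[OF _ assms(3,1)] open_Times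
        smooth_on_linear[OF bounded_linear_fst] assms) (use assms in force)
  ultimately show ?thesis
    by (simp add: riemannian_metric_on_def polar_metric_apply mult.commute)
qed

lemma sharp_polar_metric:
  assumes "f (fst x) > 0" "sin (fst x) \<noteq> 0"
  shows "sharp (polar_metric f) x (\<lambda>z. p * fst z + q * snd z)
    = (f (fst x) * p, f (fst x) * q / (sin (fst x))\<^sup>2)"
proof (rule sharp_eqI)
  fix w'
  let ?w = "(f (fst x) * p, f (fst x) * q / (sin (fst x))\<^sup>2)"
  assume *: "\<And>z. polar_metric f x w' z = polar_metric f x ?w z"
  show "w' = ?w"
    using *[of "(1, 0)"] *[of "(0, 1)"] assms by (simp add: polar_metric_apply prod_eq_iff eq_divide_eq mult.commute)
qed (use assms in \<open>simp add: polar_metric_apply field_simps\<close>)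

lemma trace_polar_metric:
  assumes "f (fst x) > 0" "sin (fst x) \<noteq> 0"
  shows "trace_metric (polar_metric f) x B
    = B (f (fst x), 0) (1, 0) + B (0, f (fst x) / (sin (fst x))\<^sup>2) (0, 1)"
proof -
  have B: "Basis = {(1, 0), (0, 1) :: real \<times> real}"
    by (auto simp: Basis_prod_def)
  have "sharp (polar_metric f) x (\<lambda>z. z \<bullet> (1, 0)) = (f (fst x), 0)"
    "sharp (polar_metric f) x (\<lambda>z. z \<bullet> (0, 1)) = (0, f (fst x) / (sin (fst x))\<^sup>2)"
    using sharp_polar_metric[where f = f, OF assms, of 1 0] sharp_polar_metric[where f = f, OF assms, of 0 1]
    by (simp_all add: inner_prod_def)
  then show ?thesis
    unfolding trace_metric_def B by simp
qed

text \<open>For a diagonal metric \<open>P dr\<^sup>2 + Q d\<theta>\<^sup>2\<close> with \<open>P\<close>, \<open>Q\<close> depending on \<open>r\<close> only, the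
  Christoffel form is given by the logarithmic derivatives \<open>l = P' / (2 P)\<close> and
  \<open>m = Q' / (2 Q)\<close>.\<close>

lemma christoffel_polar_metric:
  assumes "(f has_real_derivative f') (at (fst x))" "f (fst x) > 0" "sin (fst x) \<noteq> 0"
  defines "l \<equiv> - f' / (2 * f (fst x))" and "m \<equiv> - f' / (2 * f (fst x)) + cot (fst x)"
  shows "christoffel (polar_metric f) x u v
    = (l * (fst u * fst v) - (sin (fst x))\<^sup>2 * m * (snd u * snd v),
       m * (fst u * snd v + snd u * fst v))"
proof -
  let ?f = "f (fst x)" and ?s = "sin (fst x)" and ?c = "cos (fst x)"
  have D: "Dir (\<lambda>y. polar_metric f y v z) x u
      = 2 * fst u / ?f * (l * (fst v * fst z) + ?s\<^sup>2 * m * (snd v * snd z))" for u v z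
  proof -
    let ?G = "\<lambda>r. inverse (f r) * (fst v * fst z + (sin r)\<^sup>2 * (snd v * snd z))"
    have "(?G has_real_derivative 2 / ?f * (l * (fst v * fst z) + ?s\<^sup>2 * m * (snd v * snd z))) (at (fst x))"
      using assms(2,3)
      by (auto intro!: derivative_eq_intros assms(1)
          simp: l_def m_def cot_def power2_eq_square field_simps)
    from has_derivative_compose[OF has_derivative_fst[OF has_derivative_ident]
        this[unfolded has_field_derivative_def]]
    have "((\<lambda>y. polar_metric f y v z) has_derivative
        (\<lambda>u. 2 / ?f * (l * (fst v * fst z) + ?s\<^sup>2 * m * (snd v * snd z)) * fst u)) (at x)"
      unfolding polar_metric_apply .
    from frechet_derivative_at[OF this, symmetric] show ?thesis by (simp add: mult_ac)
  qed
  have "christoffel (polar_metric f) x u v = sharp (polar_metric f) x (\<lambda>z.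
      (l * (fst u * fst v) - ?s\<^sup>2 * m * (snd u * snd v)) / ?f * fst z
      + ?s\<^sup>2 * m * (fst u * snd v + snd u * fst v) / ?f * snd z)"
    unfolding christoffel_def D using assms(2)
    by (intro arg_cong[where f = "sharp _ _"] ext) (simp add: field_simps)
  then show ?thesis
    unfolding sharp_polar_metric[where f = f, OF assms(2,3)] using assms(2,3) by simp
qed

lemma levi_civita_const: "levi_civita g (\<lambda>_. u) (\<lambda>_. v) x = christoffel g x u v"
proof -
  have "Dir (\<lambda>_::'a. v) x = (\<lambda>_. 0)"
    by (rule frechet_derivative_at[symmetric]) simp
  then show ?thesis by (simp add: levi_civita_def)
qed

text \<open>The contributions of the derivative of \<open>f\<close> from the two directions of the trace cancel, as always
  for a conformal change in dimension two. This is why only \<open>f\<close> itself enters the tension field.\<close>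

lemma christoffel_polar_metric_trace:
  assumes "(f has_real_derivative f') (at (fst x))" "f (fst x) > 0" "sin (fst x) \<noteq> 0"
  shows "christoffel (polar_metric f) x (f (fst x), 0) (1, 0) = (- f' / 2, 0)"
    and "christoffel (polar_metric f) x (0, f (fst x) / (sin (fst x))\<^sup>2) (0, 1)
      = (f' / 2 - f (fst x) * cot (fst x), 0)"
  using assms(2,3) by (simp_all add: christoffel_polar_metric[where f = f, OF assms] field_simps)

lemma Dir_fst:
  assumes "(F has_real_derivative F') (at (fst x))"
  shows "Dir (\<lambda>y::real \<times> real. F (fst y)) x u = F' * fst u"
  by (rule frechet_derivative_at[THEN fun_cong, symmetric],
      rule has_derivative_compose[OF has_derivative_fst[OF has_derivative_ident]
        assms[unfolded has_field_derivative_def]])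

lemma laplacian_polar:
  assumes "open I" "I \<subseteq> {0<..<pi}" "open J" "smooth_on I F" "x \<in> I \<times> J"
  shows "laplacian g0 (\<lambda>x. F (fst x)) x = deriv (deriv F) (fst x) + cot (fst x) * deriv F (fst x)"
proof -
  have s: "sin (fst x) \<noteq> 0"
    using assms(2,5) sin_gt_zero[of "fst x"] by force
  have F: "(F has_real_derivative deriv F r) (at r)" if "r \<in> I" for r
    using smooth_on_real_derivative(1)[OF assms(1,4) that] .
  have F': "(deriv F has_real_derivative deriv (deriv F) (fst x)) (at (fst x))"
    using smooth_on_real_derivative[OF assms(1) smooth_on_real_derivative(2)[OF assms(1,4)]] assms(5) by auto
  have D2: "Dir (\<lambda>y. Dir (\<lambda>x. F (fst x)) y v) x u = deriv (deriv F) (fst x) * fst v * fst u" for u v :: "real \<times> real"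
  proof -
    have "((\<lambda>r. deriv F r * fst v) has_real_derivative deriv (deriv F) (fst x) * fst v) (at (fst x))"
      by (intro DERIV_cmult_right F')
    from has_derivative_compose[OF has_derivative_fst[OF has_derivative_ident]
        this[unfolded has_field_derivative_def]]
    have *: "((\<lambda>y. deriv F (fst y) * fst v) has_derivative (\<lambda>u. deriv (deriv F) (fst x) * fst v * fst u)) (at x)" .
    show ?thesis
      by (rule frechet_derivative_cong_open[OF open_Times[OF assms(1,3)] assms(5) _ *, THEN fun_cong])
        (auto simp: Dir_fst[OF F])
  qed
  have "((\<lambda>_::real. 1::real) has_real_derivative 0) (at (fst x))" by simp
  note C = christoffel_polar_metric_trace[OF this _ s, unfolded polar_metric_1, simplified]
  have F_x: "fst x \<in> I" using assms(5) by auto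
  have "laplacian g0 (\<lambda>x. F (fst x)) x
    = deriv (deriv F) (fst x) - deriv F (fst x) * fst (christoffel g0 x (1, 0) (1, 0))
      - deriv F (fst x) * fst (christoffel g0 x (0, 1 / (sin (fst x))\<^sup>2) (0, 1))"
    unfolding laplacian_def levi_civita_const
    by (simp add: D2 Dir_fst[OF F[OF F_x]]
        trace_polar_metric[where f = "\<lambda>_. 1" and x = x, OF _ s, unfolded polar_metric_1])
  then show ?thesis by (simp add: C)
qed

lemma grad_polar:
  assumes "sin (fst x) \<noteq> 0" "(F has_real_derivative F') (at (fst x))"
  shows "grad g0 (\<lambda>x. F (fst x)) x = (F', 0)"
  unfolding grad_def Dir_fst[OF assms(2)]
  using sharp_polar_metric[where f = "\<lambda>_. 1" and x = x and p = F' and q = 0] assms(1) by (simp add: polar_metric_1)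

section \<open>Rotationally symmetric maps in a stereographic chart\<close>

text \<open>The map is \<open>(r, \<theta>) \<mapsto> (\<rho> r, \<kappa> \<theta>)\<close> for radii in \<open>I\<close> and angles in \<open>J\<close>. Its values lie in
  the great 2-sphere through the poles that is determined by the plane of \<open>e1\<close> and \<open>e2\<close>; the
  dimension of the target is arbitrary.\<close>

locale rotational_data =
  fixes I J :: "real set" and \<rho> :: "real \<Rightarrow> real" and \<kappa> :: real and e1 e2 :: "'e::euclidean_space"
  assumes open_I: "open I" and I_subset: "I \<subseteq> {0<..<pi}" and open_J: "open J"
    and smooth_\<rho>: "smooth_on I \<rho>" and \<rho>_range: "\<And>r. r \<in> I \<Longrightarrow> 0 < \<rho> r \<and> \<rho> r < pi"
    and orthonormal: "e1 \<bullet> e1 = 1" "e2 \<bullet> e2 = 1" "e1 \<bullet> e2 = 0"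
begin

abbreviation U where "U \<equiv> I \<times> J"

definition sphere_map :: "real \<times> real \<Rightarrow> 'e \<times> real" where
  "sphere_map x = (sin (\<rho> (fst x)) *\<^sub>R (cos (\<kappa> * snd x) *\<^sub>R e1 + sin (\<kappa> * snd x) *\<^sub>R e2), cos (\<rho> (fst x)))"

text \<open>The component of the tension field with respect to the round metric along the unit tangent
  vectors of the meridians.\<close>

definition tension_coeff :: "real \<Rightarrow> real" where
  "tension_coeff r = deriv (deriv \<rho>) r + cot r * deriv \<rho> r - \<kappa>\<^sup>2 * (sin (\<rho> r) * cos (\<rho> r)) / (sin r)\<^sup>2"

text \<open>The linearisation of the tension coefficient in the radial function. It describes the
  Jacobi operator of the map on functions of \<open>r\<close> times the unit tangent vectors of the meridians.\<close>

definition jacobi :: "(real \<Rightarrow> real) \<Rightarrow> real \<Rightarrow> real" where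
  "jacobi F r = deriv (deriv F) r + cot r * deriv F r - \<kappa>\<^sup>2 * cos (2 * \<rho> r) / (sin r)\<^sup>2 * F r"

lemma open_U: "open U"
  using open_I open_J by (rule open_Times)

lemma sin_pos: "r \<in> I \<Longrightarrow> sin r > 0"
  using I_subset by (auto intro!: sin_gt_zero)

lemma sin_\<rho>_pos: "r \<in> I \<Longrightarrow> sin (\<rho> r) > 0"
  using \<rho>_range by (auto intro!: sin_gt_zero)

lemma smooth_on_snd: "smooth_on U (\<lambda>x. snd x)"
  by (rule smooth_on_linear[OF bounded_linear_snd open_U])

lemma \<rho>_deriv: "r \<in> I \<Longrightarrow> (\<rho> has_real_derivative deriv \<rho> r) (at r)"
  by (rule smooth_on_real_derivative(1)[OF open_I smooth_\<rho>])

lemma smooth_deriv_\<rho>: "smooth_on I (deriv \<rho>)" "smooth_on I (deriv (deriv \<rho>))"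
  using smooth_on_real_derivative(2)[OF open_I] smooth_\<rho> by auto

lemma smooth_tension_coeff: "smooth_on I tension_coeff"
proof -
  have "sin r \<noteq> 0" if "r \<in> I" for r using sin_pos[OF that] by simp
  then show ?thesis
    unfolding tension_coeff_def[abs_def]
    by (intro smooth_intros smooth_deriv_\<rho> smooth_\<rho> open_I) auto
qed

text \<open>The right-hand side consists of the three terms of the equation of an \<open>f\<close>-biharmonic map, with
  \<open>F\<close> in the role of the tension field.\<close>

lemma jacobi_mult:
  assumes "smooth_on I f" "smooth_on I F" "r \<in> I"
  shows "jacobi (\<lambda>r. f r * F r) r
    = f r * jacobi F r + (deriv (deriv f) r + cot r * deriv f r) * F r + 2 * (deriv f r * deriv F r)"
proof -
  note d = smooth_on_real_derivative(1)[OF open_I]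
  note d' = smooth_on_real_derivative(2)[OF open_I]
  have 1: "((\<lambda>r. f r * F r) has_real_derivative deriv f r * F r + deriv F r * f r) (at r)" if "r \<in> I" for r
    by (intro DERIV_mult d assms that)
  have 2: "((\<lambda>r. deriv f r * F r + deriv F r * f r) has_real_derivative
      deriv (deriv f) r * F r + deriv F r * deriv f r + (deriv (deriv F) r * f r + deriv f r * deriv F r)) (at r)"
    by (intro DERIV_add DERIV_mult d d' assms)
  have "deriv (deriv (\<lambda>r. f r * F r)) r
      = deriv (deriv f) r * F r + deriv F r * deriv f r + (deriv (deriv F) r * f r + deriv f r * deriv F r)"
    by (intro DERIV_imp_deriv has_field_derivative_transform_within_open[OF 2 open_I assms(3)])
      (use DERIV_imp_deriv[OF 1] in simp)
  then show ?thesis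
    unfolding jacobi_def DERIV_imp_deriv[OF 1[OF assms(3)]] by (simp add: algebra_simps)
qed

text \<open>The substitution \<open>t = ln (tan (r / 2))\<close>, for which \<open>d/dt = sin r d/dr\<close>, maps the round sphere
  without its poles conformally to a flat cylinder. In this variable the first order term disappears.\<close>

lemma cylinder_derivatives:
  assumes F: "\<And>r. r \<in> I \<Longrightarrow> F r = G r" and G: "\<And>r. r \<in> I \<Longrightarrow> (G has_real_derivative G1 r / sin r) (at r)"
    and G1: "\<And>r. r \<in> I \<Longrightarrow> (G1 has_real_derivative G2 r / sin r) (at r)" and r: "r \<in> I"
  shows "deriv F r = G1 r / sin r" and "deriv (deriv F) r + cot r * deriv F r = G2 r / (sin r)\<^sup>2"
proof -
  have D: "deriv F r = G1 r / sin r" if "r \<in> I" for r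
    by (intro DERIV_imp_deriv has_field_derivative_transform_within_open[OF G[OF that] open_I that])
      (simp add: F)
  then show "deriv F r = G1 r / sin r" using r .
  have sn: "sin r \<noteq> 0" using sin_pos[OF r] by simp
  have "((\<lambda>r. G1 r / sin r) has_real_derivative (G2 r / sin r * sin r - G1 r * cos r) / (sin r * sin r)) (at r)"
    by (intro DERIV_divide G1 r DERIV_sin sn)
  from has_field_derivative_transform_within_open[OF this open_I r]
  have "deriv (deriv F) r = (G2 r / sin r * sin r - G1 r * cos r) / (sin r * sin r)"
    by (intro DERIV_imp_deriv) (simp add: D)
  then show "deriv (deriv F) r + cot r * deriv F r = G2 r / (sin r)\<^sup>2"
    using sn by (simp add: D[OF r] cot_def power2_eq_square field_simps)
qed

end

text \<open>The representation of the map in the stereographic chart with sign \<open>s\<close>. For \<open>s = 1\<close> and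
  \<open>s = -1\<close> the radius in the chart is \<open>tan (\<rho> / 2)\<close> and \<open>cot (\<rho> / 2)\<close>.\<close>

locale rotational_map = rotational_data I J \<rho> \<kappa> e1 e2
  for I J :: "real set" and \<rho> :: "real \<Rightarrow> real" and \<kappa> :: real and e1 e2 :: "'e::euclidean_space" +
  fixes s :: real and \<phi> :: "real \<times> real \<Rightarrow> 'e"
  assumes s: "\<bar>s\<bar> = 1"
    and \<phi>_eq: "\<And>x. x \<in> I \<times> J \<Longrightarrow> \<phi> x
      = (sin (\<rho> (fst x)) / (1 + s * cos (\<rho> (fst x)))) *\<^sub>R (cos (\<kappa> * snd x) *\<^sub>R e1 + sin (\<kappa> * snd x) *\<^sub>R e2)"
begin

abbreviation h :: "'e metric" where "h \<equiv> induced_metric (inv_stereo s)"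

text \<open>The value of \<open>stereo_factor\<close> along the map, see \<open>stereo_factor_\<phi>\<close>.\<close>

definition m :: "real \<Rightarrow> real" where "m r = 1 + s * cos (\<rho> r)"

definition E :: "real \<Rightarrow> 'e" where "E \<theta> = cos (\<kappa> * \<theta>) *\<^sub>R e1 + sin (\<kappa> * \<theta>) *\<^sub>R e2"

definition E' :: "real \<Rightarrow> 'e" where "E' \<theta> = - sin (\<kappa> * \<theta>) *\<^sub>R e1 + cos (\<kappa> * \<theta>) *\<^sub>R e2"

text \<open>The vector with coordinates \<open>a\<close>, \<open>b\<close> in the orthonormal frame of the target along the map
  whose members are tangent to the meridians and to the circles of latitude. The sign \<open>s\<close> makes the
  first member point away from the pole \<open>\<rho> = 0\<close> in both charts.\<close>

definition frame :: "real \<times> real \<Rightarrow> real \<Rightarrow> real \<Rightarrow> 'e" where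
  "frame x a b = (s * a / m (fst x)) *\<^sub>R E (snd x) + (b / m (fst x)) *\<^sub>R E' (snd x)"

lemma ss: "s * s = 1"
  using s by (metis abs_mult_self_eq mult_1)

lemma m_pos: "r \<in> I \<Longrightarrow> m r > 0"
proof -
  assume "r \<in> I"
  then have "sin (\<rho> r) > 0" by (rule sin_\<rho>_pos)
  then have "(sin (\<rho> r))\<^sup>2 > 0" by simp
  then have "(cos (\<rho> r))\<^sup>2 < 1"
    using sin_cos_squared_add[of "\<rho> r"] by linarith
  then have "\<bar>cos (\<rho> r)\<bar> < 1" by (simp add: abs_square_less_1)
  then have "\<bar>s * cos (\<rho> r)\<bar> < 1" using s by (simp add: abs_mult)
  then show ?thesis unfolding m_def by linarith
qed

lemma sin_\<rho>_sq: "(sin (\<rho> r))\<^sup>2 = m r * (1 - s * cos (\<rho> r))"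
  using ss sin_cos_squared_add[of "\<rho> r"] unfolding m_def by algebra

lemma \<phi>_frame: "x \<in> U \<Longrightarrow> \<phi> x = (sin (\<rho> (fst x)) / m (fst x)) *\<^sub>R E (snd x)"
  using \<phi>_eq by (simp add: m_def E_def)

lemma E_inner: "E \<theta> \<bullet> E \<theta> = 1" "E' \<theta> \<bullet> E' \<theta> = 1" "E \<theta> \<bullet> E' \<theta> = 0" "E' \<theta> \<bullet> E \<theta> = 0"
  using sin_cos_squared_add[of "\<kappa> * \<theta>"]
  by (simp_all add: E_def E'_def inner_add_left inner_add_right inner_diff_left inner_diff_right orthonormal inner_commute[of e2 e1]
      power2_eq_square add.commute)

lemma frame_inner:
  assumes "fst x \<in> I"
  shows "(m (fst x))\<^sup>2 * (frame x a b \<bullet> frame x c d) = a * c + b * d"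
proof -
  have "m (fst x) \<noteq> 0" using m_pos[OF assms] by simp
  then show ?thesis
    using ss by (simp add: frame_def inner_add_left inner_add_right E_inner field_simps power2_eq_square)
qed

lemma frame_zero: "frame x 0 0 = 0"
  by (simp add: frame_def)

lemma frame_eq_0D: "fst x \<in> I \<Longrightarrow> frame x a 0 = 0 \<Longrightarrow> a = 0"
  using frame_inner[of x a 0 a 0] by simp

lemma frame_add: "frame x a b + frame x c d = frame x (a + c) (b + d)"
  and frame_diff: "frame x a b - frame x c d = frame x (a - c) (b - d)"
  and frame_scale: "t *\<^sub>R frame x a b = frame x (t * a) (t * b)"
  by (simp_all add: frame_def algebra_simps add_divide_distrib diff_divide_distrib)

lemma stereo_factor_\<phi>:
  assumes "x \<in> U"
  shows "stereo_factor (\<phi> x) = m (fst x)"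
proof -
  let ?r = "fst x"
  have m: "m ?r > 0" using assms m_pos by auto
  have "\<phi> x \<bullet> \<phi> x = (sin (\<rho> ?r))\<^sup>2 / (m ?r)\<^sup>2"
    unfolding \<phi>_frame[OF assms] by (simp add: E_inner power2_eq_square)
  also have "\<dots> = (1 - s * cos (\<rho> ?r)) / m ?r"
    unfolding sin_\<rho>_sq using m by (simp add: power2_eq_square)
  finally have "1 + \<phi> x \<bullet> \<phi> x = 2 / m ?r"
    using m by (simp add: field_simps) (simp add: m_def)
  then show ?thesis by (simp add: stereo_factor_def)
qed

text \<open>Since the base point is a multiple of \<open>E\<close>, the Christoffel form is a multiple of complex
  multiplication in the plane with real direction \<open>E\<close> and imaginary direction \<open>E'\<close>.\<close>

lemma christoffel_frame:
  assumes "x \<in> U"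
  shows "christoffel h (\<phi> x) (a *\<^sub>R E (snd x) + b *\<^sub>R E' (snd x)) (c *\<^sub>R E (snd x) + d *\<^sub>R E' (snd x))
    = (- sin (\<rho> (fst x)) * (a * c - b * d)) *\<^sub>R E (snd x)
      + (- sin (\<rho> (fst x)) * (a * d + b * c)) *\<^sub>R E' (snd x)"
proof -
  define q where "q = sin (\<rho> (fst x)) / m (fst x)"
  have sin: "sin (\<rho> (fst x)) = m (fst x) * q"
    using assms m_pos[of "fst x"] by (auto simp: q_def)
  show ?thesis
    unfolding christoffel_stereo[OF s] stereo_factor_\<phi>[OF assms]
    unfolding \<phi>_frame[OF assms] q_def[symmetric] unfolding sin
    by (simp add: inner_add_right inner_add_left E_inner algebra_simps)
qed

lemma has_derivative_E_combination:
  assumes "(a has_real_derivative a') (at (fst x))" "(b has_real_derivative b') (at (fst x))"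
  shows "((\<lambda>x. a (fst x) *\<^sub>R E (snd x) + b (fst x) *\<^sub>R E' (snd x)) has_derivative
    (\<lambda>u. (fst u * a' - snd u * \<kappa> * b (fst x)) *\<^sub>R E (snd x)
       + (fst u * b' + snd u * \<kappa> * a (fst x)) *\<^sub>R E' (snd x))) (at x)"
proof -
  have fst': "((\<lambda>y. c (fst y)) has_derivative (\<lambda>u. c' * fst u)) (at x)"
    if "(c has_real_derivative c') (at (fst x))" for c c'
    by (rule has_derivative_compose[OF has_derivative_fst[OF has_derivative_ident]
          that[unfolded has_field_derivative_def]])
  have snd': "((\<lambda>y. c (\<kappa> * snd y)) has_derivative (\<lambda>u. c' * (\<kappa> * snd u))) (at x)"
    if "(c has_real_derivative c') (at (\<kappa> * snd x))" for c c'
    by (rule has_derivative_compose[OF has_derivative_mult_right[OF has_derivative_snd[OF has_derivative_ident]]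
          that[unfolded has_field_derivative_def]])
  note d = fst'[OF assms(1)] fst'[OF assms(2)] snd'[OF DERIV_sin] snd'[OF DERIV_cos]
  show ?thesis
    unfolding E_def E'_def
    by (rule derivative_eq_intros d refl)+ (auto simp: fun_eq_iff algebra_simps)
qed

lemma m_deriv: "r \<in> I \<Longrightarrow> (m has_real_derivative - s * sin (\<rho> r) * deriv \<rho> r) (at r)"
  unfolding m_def[abs_def] by (auto intro!: derivative_eq_intros \<rho>_deriv)

lemma Dir_\<phi>:
  assumes "x \<in> U"
  shows "Dir \<phi> x u = frame x (fst u * deriv \<rho> (fst x)) (snd u * \<kappa> * sin (\<rho> (fst x)))"
proof -
  let ?r = "fst x"
  have r: "?r \<in> I" using assms by auto
  have "((\<lambda>r. sin (\<rho> r) / m r) has_real_derivative s * deriv \<rho> ?r / m ?r) (at ?r)"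
  proof -
    have "cos (\<rho> ?r) * m ?r + s * (sin (\<rho> ?r))\<^sup>2 = s * m ?r"
      using ss unfolding sin_\<rho>_sq by algebra
    then have "cos (\<rho> ?r) * deriv \<rho> ?r * m ?r - sin (\<rho> ?r) * (- s * sin (\<rho> ?r) * deriv \<rho> ?r)
        = s * m ?r * deriv \<rho> ?r"
      by algebra
    moreover have "((\<lambda>r. sin (\<rho> r)) has_real_derivative cos (\<rho> ?r) * deriv \<rho> ?r) (at ?r)"
      by (auto intro!: derivative_eq_intros \<rho>_deriv[OF r])
    ultimately show ?thesis
      using m_pos[OF r] DERIV_divide[OF _ m_deriv[OF r]] by fastforce
  qed
  from has_derivative_E_combination[OF this, of "\<lambda>_. 0" 0]
  have "Dir \<phi> x = (\<lambda>u. (fst u * (s * deriv \<rho> ?r / m ?r)) *\<^sub>R E (snd x)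
      + (snd u * \<kappa> * (sin (\<rho> ?r) / m ?r)) *\<^sub>R E' (snd x))"
    by (intro frechet_derivative_cong_open[OF open_U assms, where
          G = "\<lambda>x. (sin (\<rho> (fst x)) / m (fst x)) *\<^sub>R E (snd x) + 0 *\<^sub>R E' (snd x)"])
      (auto simp: \<phi>_frame)
  then show ?thesis by (simp add: frame_def mult_ac)
qed

text \<open>The orthonormal frame is parallel in the direction of \<open>r\<close> and rotates with speed \<open>\<kappa> cos \<rho>\<close> in
  the direction of \<open>\<theta>\<close>. Neither the sign \<open>s\<close> nor the conformal factor is left in this description.\<close>

lemma pullback_connection_frame:
  assumes x: "x \<in> U"
    and V: "\<And>y. y \<in> U \<Longrightarrow> V y = frame y (F (fst y)) (G (fst y))"
    and F: "(F has_real_derivative F') (at (fst x))" and G: "(G has_real_derivative G') (at (fst x))"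
  shows "pullback_connection h \<phi> X V x
    = frame x (fst (X x) * F' - snd (X x) * \<kappa> * cos (\<rho> (fst x)) * G (fst x))
        (fst (X x) * G' + snd (X x) * \<kappa> * cos (\<rho> (fst x)) * F (fst x))"
proof -
  define r p c u1 u2 where "r = fst x" and "p = deriv \<rho> r" and "c = cos (\<rho> r)"
    and "u1 = fst (X x)" and "u2 = snd (X x)"
  have r: "r \<in> I" using x by (auto simp: r_def)
  have m: "m r > 0" using m_pos[OF r] .
  note F = F[folded r_def] and G = G[folded r_def] and dm = m_deriv[OF r, folded p_def]
  have dF: "((\<lambda>r. s * F r / m r) has_real_derivative s * F' / m r + s * s * sin (\<rho> r) * p * F r / (m r)\<^sup>2) (at r)"
    by (rule DERIV_cong, rule DERIV_divide[OF DERIV_cmult[OF F] dm])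
      (use m in \<open>simp_all add: field_simps power2_eq_square\<close>)
  have dG: "((\<lambda>r. G r / m r) has_real_derivative G' / m r + s * sin (\<rho> r) * p * G r / (m r)\<^sup>2) (at r)"
    by (rule DERIV_cong, rule DERIV_divide[OF G dm])
      (use m in \<open>simp_all add: field_simps power2_eq_square\<close>)
  have "Dir V x = (\<lambda>u. (fst u * (s * F' / m r + s * s * sin (\<rho> r) * p * F r / (m r)\<^sup>2) - snd u * \<kappa> * (G r / m r)) *\<^sub>R E (snd x)
      + (fst u * (G' / m r + s * sin (\<rho> r) * p * G r / (m r)\<^sup>2) + snd u * \<kappa> * (s * F r / m r)) *\<^sub>R E' (snd x))"
    using has_derivative_E_combination[OF dF[unfolded r_def] dG[unfolded r_def]]
    by (intro frechet_derivative_cong_open[OF open_U x V]) (simp_all add: frame_def[abs_def] r_def)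
  then have "pullback_connection h \<phi> X V x
    = (u1 * (s * F' / m r + s * s * sin (\<rho> r) * p * F r / (m r)\<^sup>2) - u2 * \<kappa> * (G r / m r)
        - sin (\<rho> r) * (s * (u1 * p) / m r * (s * F r / m r)
            - u2 * \<kappa> * sin (\<rho> r) / m r * (G r / m r))) *\<^sub>R E (snd x)
      + (u1 * (G' / m r + s * sin (\<rho> r) * p * G r / (m r)\<^sup>2) + u2 * \<kappa> * (s * F r / m r)
        - sin (\<rho> r) * (s * (u1 * p) / m r * (G r / m r)
            + u2 * \<kappa> * sin (\<rho> r) / m r * (s * F r / m r))) *\<^sub>R E' (snd x)" (is "_ = ?a *\<^sub>R _ + ?b *\<^sub>R _")
    unfolding pullback_connection_def V[OF x] Dir_\<phi>[OF x] frame_def christoffel_frame[OF x]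
    by (simp add: r_def p_def u1_def u2_def algebra_simps)
  also have "?a = s * (u1 * F' - u2 * \<kappa> * c * G r) / m r"
  proof -
    have "?a = s * u1 * F' / m r - u2 * \<kappa> * G r * (m r - (sin (\<rho> r))\<^sup>2) / (m r)\<^sup>2"
      using m by (simp add: field_simps power2_eq_square)
    also have "m r - (sin (\<rho> r))\<^sup>2 = m r * (s * c)"
      unfolding sin_\<rho>_sq c_def by (simp add: algebra_simps)
    finally show ?thesis using m by (simp add: field_simps power2_eq_square)
  qed
  also have "?b = (u1 * G' + u2 * \<kappa> * c * F r) / m r"
  proof -
    have "?b = u1 * G' / m r + s * u2 * \<kappa> * F r * (m r - (sin (\<rho> r))\<^sup>2) / (m r)\<^sup>2"
      using m by (simp add: field_simps power2_eq_square)
    also have "m r - (sin (\<rho> r))\<^sup>2 = m r * (s * c)"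
      unfolding sin_\<rho>_sq c_def by (simp add: algebra_simps)
    also have "s * u2 * \<kappa> * F r * (m r * (s * c)) / (m r)\<^sup>2 = (s * s) * u2 * \<kappa> * F r * c / m r"
      using m by (simp add: field_simps power2_eq_square)
    finally show ?thesis using m ss by (simp add: add_divide_distrib mult_ac)
  qed
  finally show ?thesis by (simp add: frame_def r_def c_def u1_def u2_def)
qed

end

context rotational_map
begin

lemma smooth_\<phi>: "smooth_on U \<phi>"
proof (rule smooth_on_cong[OF _ open_U \<phi>_eq[symmetric]])
  note \<rho> = smooth_on_fst[OF smooth_\<rho> open_J open_I]
  have "1 + s * cos (\<rho> (fst x)) \<noteq> 0" if "x \<in> U" for x
    using that m_pos[of "fst x"] by (auto simp: m_def)
  then show "smooth_on U (\<lambda>x. (sin (\<rho> (fst x)) / (1 + s * cos (\<rho> (fst x))))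
      *\<^sub>R (cos (\<kappa> * snd x) *\<^sub>R e1 + sin (\<kappa> * snd x) *\<^sub>R e2))"
    by (intro smooth_intros open_U \<rho> smooth_on_snd)
qed

lemma smooth_riemannian_map_\<phi>:
  assumes "smooth_on I f" "\<And>r. r \<in> I \<Longrightarrow> f r > 0"
  shows "smooth_riemannian_map U (polar_metric f) UNIV h \<phi>"
  unfolding smooth_riemannian_map_def
  using riemannian_polar_metric[OF open_I I_subset open_J assms] riemannian_metric_stereo[OF s]
    smooth_\<phi> open_U by simp

text \<open>In the trace, the direction of \<open>r\<close> gives \<open>\<rho>''\<close>, the rotation of the frame gives the term with
  \<open>\<kappa>\<^sup>2\<close>, and the Christoffel form of the domain gives \<open>cot r \<rho>'\<close>.\<close>

lemma tension_frame:
  assumes f: "smooth_on I f" "\<And>r. r \<in> I \<Longrightarrow> f r > 0" and x: "x \<in> U"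
  shows "tension (polar_metric f) h \<phi> x = frame x (f (fst x) * tension_coeff (fst x)) 0"
proof -
  define r where "r = fst x"
  have r: "r \<in> I" "fst x \<in> I" using x by (auto simp: r_def)
  have sn: "sin (fst x) \<noteq> 0" using sin_pos[OF r(2)] by simp
  note C = christoffel_polar_metric_trace[where f = f, OF smooth_on_real_derivative(1)[OF open_I f(1) r(2)] f(2)[OF r(2)] sn]
  have P: "pullback_connection h \<phi> (\<lambda>_. u) (\<lambda>y. Dir \<phi> y v) x
    = frame x (fst u * (fst v * deriv (deriv \<rho>) r) - snd u * \<kappa> * cos (\<rho> r) * (snd v * \<kappa> * sin (\<rho> r)))
      (fst u * (snd v * \<kappa> * (cos (\<rho> r) * deriv \<rho> r)) + snd u * \<kappa> * cos (\<rho> r) * (fst v * deriv \<rho> r))" for u v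
    unfolding r_def
    by (rule pullback_connection_frame[OF x Dir_\<phi>])
      (auto intro!: derivative_eq_intros \<rho>_deriv[OF r(2)] smooth_on_real_derivative(1)[OF open_I smooth_deriv_\<rho>(1) r(2)])
  show ?thesis
    unfolding tension_def trace_polar_metric[where f = f, OF f(2)[OF r(2)] sn]
      second_fundamental_form_def levi_civita_const P C Dir_\<phi>[OF x] frame_add frame_diff
    using sn f(2)[OF r(2)]
    by (simp add: tension_coeff_def r_def algebra_simps power2_eq_square)
qed

lemma curvature_frame:
  assumes "x \<in> U"
  shows "curvature h (\<phi> x) (frame x a b) (frame x c d) (frame x a' b')
    = frame x ((c * a' + d * b') * a - (a * a' + b * b') * c) ((c * a' + d * b') * b - (a * a' + b * b') * d)"
proof -
  have "fst x \<in> I" using assms by auto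
  note i = frame_inner[OF this]
  have "curvature h (\<phi> x) (frame x a b) (frame x c d) (frame x a' b')
    = ((m (fst x))\<^sup>2 * (frame x c d \<bullet> frame x a' b')) *\<^sub>R frame x a b
      - ((m (fst x))\<^sup>2 * (frame x a b \<bullet> frame x a' b')) *\<^sub>R frame x c d"
    unfolding curvature_stereo[OF s] stereo_factor_\<phi>[OF assms] by (simp add: algebra_simps)
  then show ?thesis by (simp only: i frame_scale frame_diff)
qed

text \<open>Differentiating the tension field twice gives the term \<open>- \<kappa>\<^sup>2 cos\<^sup>2 \<rho>\<close>, and the curvature gives
  \<open>+ \<kappa>\<^sup>2 sin\<^sup>2 \<rho>\<close>; together they are the potential \<open>- \<kappa>\<^sup>2 cos (2 \<rho>)\<close> of the Jacobi operator.\<close>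

lemma bitension_frame:
  assumes f: "smooth_on I f" "\<And>r. r \<in> I \<Longrightarrow> f r > 0" and x: "x \<in> U"
  shows "bitension (polar_metric f) h \<phi> x
    = frame x (f (fst x) * jacobi (\<lambda>r. f r * tension_coeff r) (fst x)) 0"
proof -
  define r where "r = fst x"
  have r: "r \<in> I" "fst x \<in> I" using x by (auto simp: r_def)
  have sn: "sin (fst x) \<noteq> 0" using sin_pos[OF r(2)] by simp
  define F where "F = (\<lambda>r. f r * tension_coeff r)"
  have smooth_F: "smooth_on I F"
    unfolding F_def by (intro smooth_on_mult open_I f smooth_tension_coeff)
  note dF = smooth_on_real_derivative(1)[OF open_I smooth_F]
    and ddF = smooth_on_real_derivative(1)[OF open_I smooth_on_real_derivative(2)[OF open_I smooth_F]]
  note C = christoffel_polar_metric_trace[where f = f, OF smooth_on_real_derivative(1)[OF open_I f(1) r(2)] f(2)[OF r(2)] sn]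
  have T: "tension (polar_metric f) h \<phi> y = frame y (F (fst y)) 0" if "y \<in> U" for y
    using tension_frame[OF f that] by (simp add: F_def)
  have P: "pullback_connection h \<phi> X (tension (polar_metric f) h \<phi>) y
    = frame y (fst (X y) * deriv F (fst y)) (snd (X y) * \<kappa> * cos (\<rho> (fst y)) * F (fst y))" if "y \<in> U" for X y
  proof -
    have "fst y \<in> I" using that by auto
    from pullback_connection_frame[OF that T dF[OF this] DERIV_const, of X]
    show ?thesis by simp
  qed
  have PP: "pullback_connection h \<phi> (\<lambda>_. u) (pullback_connection h \<phi> (\<lambda>_. v) (tension (polar_metric f) h \<phi>)) x
    = frame x (fst u * (fst v * deriv (deriv F) r) - snd u * \<kappa> * cos (\<rho> r) * (snd v * \<kappa> * cos (\<rho> r) * F r))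
      (fst u * (snd v * \<kappa> * (cos (\<rho> r) * deriv F r - sin (\<rho> r) * deriv \<rho> r * F r))
        + snd u * \<kappa> * cos (\<rho> r) * (fst v * deriv F r))" for u v
    unfolding r_def
    by (rule pullback_connection_frame[OF x P])
      (auto intro!: derivative_eq_intros \<rho>_deriv[OF r(2)] dF[OF r(2)] ddF[OF r(2)] simp: algebra_simps)
  have cos_2: "cos (2 * \<rho> r) = cos (\<rho> r) * cos (\<rho> r) - sin (\<rho> r) * sin (\<rho> r)"
    by (simp add: cos_double power2_eq_square)
  show ?thesis
    unfolding bitension_def trace_polar_metric[where f = f, OF f(2)[OF r(2)] sn] P[OF x] PP
      levi_civita_const C Dir_\<phi>[OF x] T[OF x] curvature_frame[OF x] frame_add frame_diff
    using sn f(2)[OF r(2)]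
    by (simp add: jacobi_def r_def cos_2[unfolded r_def] F_def[symmetric] diff_divide_distrib add_divide_distrib
        algebra_simps power2_eq_square)
qed

lemma f_biharmonic_if_jacobi:
  assumes f: "smooth_on I f" "\<And>r. r \<in> I \<Longrightarrow> f r > 0"
    and J: "\<And>r. r \<in> I \<Longrightarrow> jacobi (\<lambda>r. f r * tension_coeff r) r = 0"
  shows "f_biharmonic (\<lambda>x. f (fst x)) U g0 UNIV h \<phi>"
proof -
  have one: "smooth_on I (\<lambda>_. 1 :: real)" "\<And>r::real. r \<in> I \<Longrightarrow> (1::real) > 0"
    by (simp_all add: smooth_on_const)
  have T: "tension g0 h \<phi> x = frame x (tension_coeff (fst x)) 0" if "x \<in> U" for x
    using tension_frame[OF one that] by (simp add: polar_metric_1)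
  have "f (fst x) *\<^sub>R bitension g0 h \<phi> x + laplacian g0 (\<lambda>x. f (fst x)) x *\<^sub>R tension g0 h \<phi> x
        + 2 *\<^sub>R pullback_connection h \<phi> (grad g0 (\<lambda>x. f (fst x))) (tension g0 h \<phi>) x = 0"
    if x: "x \<in> U" for x
  proof -
    have r: "fst x \<in> I" using x by auto
    have sn: "sin (fst x) \<noteq> 0" using sin_pos[OF r] by simp
    have B: "bitension g0 h \<phi> x = frame x (jacobi tension_coeff (fst x)) 0"
      using bitension_frame[OF one x] by (simp add: polar_metric_1)
    have "pullback_connection h \<phi> (grad g0 (\<lambda>x. f (fst x))) (tension g0 h \<phi>) x
        = frame x (deriv f (fst x) * deriv tension_coeff (fst x)) 0"
      using pullback_connection_frame[OF x T
          smooth_on_real_derivative(1)[OF open_I smooth_tension_coeff r] DERIV_const,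
          of "grad g0 (\<lambda>x. f (fst x))"]
      by (simp add: grad_polar[OF sn smooth_on_real_derivative(1)[OF open_I f(1) r]])
    then show ?thesis
      unfolding B T[OF x] laplacian_polar[OF open_I I_subset open_J f(1) x]
      using J[OF r] jacobi_mult[OF f(1) smooth_tension_coeff r]
      by (simp add: frame_scale frame_add frame_zero)
  qed
  moreover have "smooth_riemannian_map U g0 UNIV h \<phi>"
    using smooth_riemannian_map_\<phi>[OF one] by (simp add: polar_metric_1)
  moreover have "smooth_on U (\<lambda>x. f (fst x))"
    by (rule smooth_on_fst[OF f(1) open_J open_I])
  ultimately show ?thesis
    using f(2) by (auto simp: f_biharmonic_def)
qed

lemma biharmonic_if_jacobi:
  assumes f: "smooth_on I f" "\<And>r. r \<in> I \<Longrightarrow> f r > 0"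
    and J: "\<And>r. r \<in> I \<Longrightarrow> jacobi (\<lambda>r. f r * tension_coeff r) r = 0"
  shows "biharmonic U (polar_metric f) UNIV h \<phi>"
  using smooth_riemannian_map_\<phi>[OF f] bitension_frame[OF f] J
  by (auto simp: biharmonic_def frame_zero)

lemma not_harmonic:
  assumes f: "smooth_on I f" "\<And>r. r \<in> I \<Longrightarrow> f r > 0"
    and r: "r \<in> I" "J \<noteq> {}" "tension_coeff r \<noteq> 0"
  shows "\<not> harmonic U (polar_metric f) UNIV h \<phi>"
proof
  assume H: "harmonic U (polar_metric f) UNIV h \<phi>"
  obtain \<theta> where "\<theta> \<in> J" using r by auto
  then have x: "(r, \<theta>) \<in> U" using r by simp
  then have "frame (r, \<theta>) (f r * tension_coeff r) 0 = 0"
    using H tension_frame[OF f x] by (simp add: harmonic_def)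
  then have "f r * tension_coeff r = 0"
    using frame_eq_0D[of "(r, \<theta>)" "f r * tension_coeff r"] r(1) by (simp only: fst_conv)
  then show False using f(2)[of r] r by simp
qed

text \<open>The map stretches the unit vectors in the directions of \<open>r\<close> and \<open>\<theta>\<close> by \<open>\<bar>\<rho>'\<bar>\<close> and
  \<open>\<bar>\<kappa> sin \<rho> / sin r\<bar>\<close>, up to the same conformal factor.\<close>

lemma not_weakly_conformal:
  assumes f: "\<And>r. r \<in> I \<Longrightarrow> f r > 0"
    and r: "r \<in> I" "J \<noteq> {}" "(sin r * deriv \<rho> r)\<^sup>2 \<noteq> (\<kappa> * sin (\<rho> r))\<^sup>2"
  shows "\<not> weakly_conformal U (polar_metric f) UNIV h \<phi>"
proof
  assume "weakly_conformal U (polar_metric f) UNIV h \<phi>"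
  then obtain \<mu> where \<mu>: "\<And>x u v. x \<in> U \<Longrightarrow> h (\<phi> x) (Dir \<phi> x u) (Dir \<phi> x v) = \<mu> x * polar_metric f x u v"
    unfolding weakly_conformal_def by blast
  obtain \<theta> where "\<theta> \<in> J" using r by auto
  then have x: "(r, \<theta>) \<in> U" using r by simp
  have i: "h (\<phi> x) (frame x a b) (frame x c d) = a * c + b * d" if "x \<in> U" for x a b c d
    using frame_inner[of x a b c d] that by (auto simp: induced_metric_inv_stereo[OF s] stereo_factor_\<phi>[OF that])
  have "(deriv \<rho> r)\<^sup>2 = \<mu> (r, \<theta>) * inverse (f r)"
    "(\<kappa> * sin (\<rho> r))\<^sup>2 = \<mu> (r, \<theta>) * inverse (f r) * (sin r)\<^sup>2"
    using \<mu>[OF x, of "(1, 0)" "(1, 0)"] \<mu>[OF x, of "(0, 1)" "(0, 1)"]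
    by (simp_all add: Dir_\<phi>[OF x] i[OF x] polar_metric_apply power2_eq_square mult_ac)
  then show False using r(3) by (simp add: power_mult_distrib)
qed

end

section \<open>Rotationally symmetric maps into the sphere\<close>

text \<open>So \<open>\<phi>\<close> agrees on its domain with \<open>sphere_map\<close> followed by the inverse of the chart.\<close>

lemma (in rotational_map) inv_stereo_\<phi>:
  assumes "x \<in> U"
  shows "inv_stereo s (\<phi> x) = sphere_map x"
proof -
  have m: "m (fst x) \<noteq> 0" using assms m_pos[of "fst x"] by auto
  have "s * (m (fst x) - 1) = s * s * cos (\<rho> (fst x))"
    by (simp add: m_def)
  then show ?thesis
    unfolding inv_stereo_eq stereo_factor_\<phi>[OF assms] using m ss
    by (simp add: \<phi>_frame[OF assms] sphere_map_def E_def)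
qed

context rotational_data
begin

lemma chart_representation:
  assumes s: "\<bar>s\<bar> = 1"
  shows "rotational_map I J \<rho> \<kappa> e1 e2 s (inv (inv_stereo s) \<circ> sphere_map)"
    and "x \<in> U \<Longrightarrow> sphere_map x \<in> range (inv_stereo s)"
proof -
  interpret M: rotational_map I J \<rho> \<kappa> e1 e2 s "\<lambda>x. (sin (\<rho> (fst x)) / (1 + s * cos (\<rho> (fst x))))
      *\<^sub>R (cos (\<kappa> * snd x) *\<^sub>R e1 + sin (\<kappa> * snd x) *\<^sub>R e2)"
    by unfold_locales (use s in auto)
  show "x \<in> U \<Longrightarrow> sphere_map x \<in> range (inv_stereo s)" for x
    using M.inv_stereo_\<phi>[of x] by (metis rangeI)
  show "rotational_map I J \<rho> \<kappa> e1 e2 s (inv (inv_stereo s) \<circ> sphere_map)"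
  proof (unfold_locales)
    fix x assume "x \<in> I \<times> J"
    from M.inv_stereo_\<phi>[OF this]
    show "(inv (inv_stereo s) \<circ> sphere_map) x = (sin (\<rho> (fst x)) / (1 + s * cos (\<rho> (fst x))))
      *\<^sub>R (cos (\<kappa> * snd x) *\<^sub>R e1 + sin (\<kappa> * snd x) *\<^sub>R e2)"
      using inv_f_f[OF range_inv_stereo(2)[OF s]] by (metis (no_types, lifting) comp_apply)
  qed (fact s)
qed

lemma continuous_on_sphere_map: "continuous_on U sphere_map"
proof -
  have "continuous_on U (\<lambda>x. \<rho> (fst x))"
    by (rule smooth_on_imp_continuous_on[OF smooth_on_fst[OF smooth_\<rho> open_J open_I]])
  then show ?thesis
    unfolding sphere_map_def[abs_def] by (intro continuous_intros)
qed

text \<open>The values of the map are not poles, so that both charts can be used on the whole domain.\<close>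

lemma in_sphere_charts_iff:
  "in_sphere_charts P U sphere_map
    \<longleftrightarrow> (\<forall>s\<in>{1, -1}. P U UNIV (induced_metric (inv_stereo s)) (inv (inv_stereo s) \<circ> sphere_map))"
proof -
  have *: "sphere_map x \<in> range (inv_stereo s)" if "x \<in> U" "s \<in> {1, -1}" for x s
    by (rule chart_representation(2)[OF _ that(1)]) (use that(2) in auto)
  have "U \<inter> sphere_map -` range (inv_stereo s) = U" if "s \<in> {1, -1}" for s
    using *[OF _ that] by blast
  moreover have "sphere_map \<in> U \<rightarrow> sphere 0 1"
    using *[of _ 1] range_inv_stereo(1)[of 1] by auto
  ultimately show ?thesis
    unfolding in_sphere_charts_def using open_U continuous_on_sphere_map by auto
qed

text \<open>All conditions are expressed with the derivation \<open>sin r d/dr\<close> of the flat cylinder. There the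
  tension field has the coefficient \<open>R2 - \<kappa>\<^sup>2 sin \<rho> cos \<rho>\<close> up to the factor \<open>sin\<^sup>2 r\<close>, and \<open>G\<close> is
  the coefficient of its product with \<open>f\<close>, which has to solve the linearised equation.\<close>

theorem f_biharmonic_criterion:
  assumes J: "J \<noteq> {}" and f: "smooth_on I f" "\<And>r. r \<in> I \<Longrightarrow> f r > 0"
    and R: "\<And>r. r \<in> I \<Longrightarrow> (\<rho> has_real_derivative R1 r / sin r) (at r)"
      "\<And>r. r \<in> I \<Longrightarrow> (R1 has_real_derivative R2 r / sin r) (at r)"
    and fG: "\<And>r. r \<in> I \<Longrightarrow> f r * (R2 r - \<kappa>\<^sup>2 * (sin (\<rho> r) * cos (\<rho> r))) = (sin r)\<^sup>2 * G r"
    and G: "\<And>r. r \<in> I \<Longrightarrow> (G has_real_derivative G1 r / sin r) (at r)"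
      "\<And>r. r \<in> I \<Longrightarrow> (G1 has_real_derivative \<kappa>\<^sup>2 * cos (2 * \<rho> r) * G r / sin r) (at r)"
    and r: "r \<in> I" "G r \<noteq> 0" "(R1 r)\<^sup>2 \<noteq> (\<kappa> * sin (\<rho> r))\<^sup>2"
  shows "f_biharmonic_to_sphere (\<lambda>x. f (fst x)) U g0 sphere_map"
    and "proper_biharmonic_to_sphere U (polar_metric f) sphere_map"
    and "\<not> weakly_conformal_to_sphere U (polar_metric f) sphere_map"
proof -
  have T: "f r * tension_coeff r = G r" if "r \<in> I" for r
  proof -
    have "tension_coeff r = (R2 r - \<kappa>\<^sup>2 * (sin (\<rho> r) * cos (\<rho> r))) / (sin r)\<^sup>2"
      using cylinder_derivatives(2)[OF refl R that] by (simp add: tension_coeff_def diff_divide_distrib)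
    then show ?thesis
      using fG[OF that] sin_pos[OF that] by simp
  qed
  have J0: "jacobi (\<lambda>r. f r * tension_coeff r) r = 0" if "r \<in> I" for r
    using cylinder_derivatives(2)[OF T G that] by (simp add: jacobi_def T[OF that])
  note jacobi = f J0
  note [simp] = in_sphere_charts_iff f_biharmonic_to_sphere_def proper_biharmonic_to_sphere_def
    biharmonic_to_sphere_def harmonic_to_sphere_def weakly_conformal_to_sphere_def
  interpret M1: rotational_map I J \<rho> \<kappa> e1 e2 1 "inv (inv_stereo 1) \<circ> sphere_map"
    by (rule chart_representation) simp
  interpret M2: rotational_map I J \<rho> \<kappa> e1 e2 "-1" "inv (inv_stereo (-1)) \<circ> sphere_map"
    by (rule chart_representation) simp
  show "f_biharmonic_to_sphere (\<lambda>x. f (fst x)) U g0 sphere_map"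
    using M1.f_biharmonic_if_jacobi[OF jacobi] M2.f_biharmonic_if_jacobi[OF jacobi] by simp
  have "tension_coeff r \<noteq> 0" using T[OF r(1)] r(2) by auto
  then show "proper_biharmonic_to_sphere U (polar_metric f) sphere_map"
    using M1.biharmonic_if_jacobi[OF jacobi] M2.biharmonic_if_jacobi[OF jacobi]
      M1.not_harmonic[OF f r(1) J] by simp
  have "sin r * deriv \<rho> r = R1 r"
    using DERIV_imp_deriv[OF R(1)[OF r(1)]] sin_pos[OF r(1)] by simp
  then show "\<not> weakly_conformal_to_sphere U (polar_metric f) sphere_map"
    using M1.not_weakly_conformal[OF f(2) r(1) J] r(3) by simp
qed

end

text \<open>The conditions on the radial data in the criterion, which do not mention the target.\<close>

definition biharmonic_profile :: "real set \<Rightarrow> (real \<Rightarrow> real) \<Rightarrow> real \<Rightarrow> (real \<Rightarrow> real) \<Rightarrow> bool" where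
  "biharmonic_profile I \<rho> \<kappa> f \<longleftrightarrow> open I \<and> I \<subseteq> {0<..<pi} \<and> smooth_on I \<rho> \<and> \<rho> \<in> I \<rightarrow> {0<..<pi} \<and>
    smooth_on I f \<and> (\<forall>r\<in>I. f r > 0) \<and>
    (\<exists>R1 R2 G G1. (\<forall>r\<in>I.
      (\<rho> has_real_derivative R1 r / sin r) (at r) \<and>
      (R1 has_real_derivative R2 r / sin r) (at r) \<and>
      f r * (R2 r - \<kappa>\<^sup>2 * (sin (\<rho> r) * cos (\<rho> r))) = (sin r)\<^sup>2 * G r \<and>
      (G has_real_derivative G1 r / sin r) (at r) \<and>
      (G1 has_real_derivative \<kappa>\<^sup>2 * cos (2 * \<rho> r) * G r / sin r) (at r)) \<and>
     (\<exists>r\<in>I. G r \<noteq> 0 \<and> (R1 r)\<^sup>2 \<noteq> (\<kappa> * sin (\<rho> r))\<^sup>2))"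

lemma biharmonic_profileI:
  assumes "open I" "I \<subseteq> {0<..<pi}" "smooth_on I \<rho>" "\<rho> \<in> I \<rightarrow> {0<..<pi}"
    and "smooth_on I f" "\<And>r. r \<in> I \<Longrightarrow> f r > 0"
    and "\<And>r. r \<in> I \<Longrightarrow> (\<rho> has_real_derivative R1 r / sin r) (at r)"
    and "\<And>r. r \<in> I \<Longrightarrow> (R1 has_real_derivative R2 r / sin r) (at r)"
    and "\<And>r. r \<in> I \<Longrightarrow> f r * (R2 r - \<kappa>\<^sup>2 * (sin (\<rho> r) * cos (\<rho> r))) = (sin r)\<^sup>2 * G r"
    and "\<And>r. r \<in> I \<Longrightarrow> (G has_real_derivative G1 r / sin r) (at r)"
    and "\<And>r. r \<in> I \<Longrightarrow> (G1 has_real_derivative \<kappa>\<^sup>2 * cos (2 * \<rho> r) * G r / sin r) (at r)"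
    and "r \<in> I" "G r \<noteq> 0" "(R1 r)\<^sup>2 \<noteq> (\<kappa> * sin (\<rho> r))\<^sup>2"
  shows "biharmonic_profile I \<rho> \<kappa> f"
  unfolding biharmonic_profile_def
  by (intro conjI ballI exI[of _ R1] exI[of _ R2] exI[of _ G] exI[of _ G1] bexI[of _ r] assms)

lemma biharmonic_profile_sphere_map:
  fixes e1 e2 :: "'e::euclidean_space"
  assumes profile: "biharmonic_profile I \<rho> \<kappa> f" and "open J" "J \<noteq> {}"
    and "e1 \<bullet> e1 = 1" "e2 \<bullet> e2 = 1" "e1 \<bullet> e2 = 0"
  defines "\<Phi> \<equiv> \<lambda>x. (sin (\<rho> (fst x)) *\<^sub>R (cos (\<kappa> * snd x) *\<^sub>R e1 + sin (\<kappa> * snd x) *\<^sub>R e2), cos (\<rho> (fst x)))"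
  shows "f_biharmonic_to_sphere (\<lambda>x. f (fst x)) (I \<times> J) g0 \<Phi>"
    and "proper_biharmonic_to_sphere (I \<times> J) (polar_metric f) \<Phi>"
    and "\<not> weakly_conformal_to_sphere (I \<times> J) (polar_metric f) \<Phi>"
proof -
  interpret rotational_data I J \<rho> \<kappa> e1 e2
    by unfold_locales (use assms(2-6) profile in \<open>auto simp: biharmonic_profile_def Pi_iff\<close>)
  obtain R1 R2 G G1 r where D: "\<And>r. r \<in> I \<Longrightarrow>
      (\<rho> has_real_derivative R1 r / sin r) (at r) \<and>
      (R1 has_real_derivative R2 r / sin r) (at r) \<and>
      f r * (R2 r - \<kappa>\<^sup>2 * (sin (\<rho> r) * cos (\<rho> r))) = (sin r)\<^sup>2 * G r \<and>
      (G has_real_derivative G1 r / sin r) (at r) \<and>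
      (G1 has_real_derivative \<kappa>\<^sup>2 * cos (2 * \<rho> r) * G r / sin r) (at r)"
    and r: "r \<in> I" "G r \<noteq> 0" "(R1 r)\<^sup>2 \<noteq> (\<kappa> * sin (\<rho> r))\<^sup>2"
    using profile unfolding biharmonic_profile_def by (elim conjE exE bexE) blast
  have f: "smooth_on I f" "\<And>r. r \<in> I \<Longrightarrow> f r > 0"
    using profile by (auto simp: biharmonic_profile_def)
  have "sphere_map = \<Phi>"
    by (simp add: \<Phi>_def sphere_map_def fun_eq_iff)
  then show "f_biharmonic_to_sphere (\<lambda>x. f (fst x)) (I \<times> J) g0 \<Phi>"
    and "proper_biharmonic_to_sphere (I \<times> J) (polar_metric f) \<Phi>"
    and "\<not> weakly_conformal_to_sphere (I \<times> J) (polar_metric f) \<Phi>"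
    using f_biharmonic_criterion[of f R1 R2 G G1 r] D r f assms(3) by blast+
qed


section \<open>The four radial profiles\<close>

text \<open>The sign of a continuous function is locally constant where the function does not vanish.\<close>

lemma DERIV_sgn_mult:
  fixes p H :: "real \<Rightarrow> real"
  assumes "open I" "continuous_on I p" "r \<in> I" "p r \<noteq> 0" "(H has_real_derivative D) (at r)"
  shows "((\<lambda>r. sgn (p r) * H r) has_real_derivative sgn (p r) * D) (at r)"
proof -
  have "isCont p r" using assms(1-3) by (simp add: continuous_on_eq_continuous_at)
  then have "eventually (\<lambda>y. sgn (p y) = sgn (p r)) (nhds r)"
  proof (cases "p r > 0")
    case True
    then have "eventually (\<lambda>y. p y > 0) (nhds r)"
      using \<open>isCont p r\<close> by (metis isCont_def order_tendstoD(1) tendsto_at_iff_tendsto_nhds)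
    then show ?thesis using True by (auto elim: eventually_mono)
  next
    case False
    then have neg: "p r < 0" using assms(4) by simp
    then have "eventually (\<lambda>y. p y < 0) (nhds r)"
      using \<open>isCont p r\<close> by (metis isCont_def order_tendstoD(2) tendsto_at_iff_tendsto_nhds)
    then show ?thesis using neg by (auto elim: eventually_mono)
  qed
  then have "eventually (\<lambda>y. sgn (p y) * H y = sgn (p r) * H y) (nhds r)"
    by (auto elim: eventually_mono)
  then show ?thesis
    using DERIV_cmult[OF assms(5), of "sgn (p r)"] by (subst DERIV_cong_ev[OF refl _ refl]) auto
qed

text \<open>For a radial identity map with \<open>\<kappa>\<^sup>2 \<noteq> 1\<close> the tension field is a multiple of \<open>cot r\<close>. If \<open>p\<close>
  is the weight before the absolute value is taken, then its sign is locally constant, and a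
  solution of the linear equation stays one after multiplication by this sign.\<close>

lemma biharmonic_profile_id:
  assumes I: "open I" "I \<subseteq> {0<..<pi}" "I \<noteq> {}" "\<And>r. r \<in> I \<Longrightarrow> cos r \<noteq> 0" and \<kappa>: "\<kappa>\<^sup>2 \<noteq> 1"
    and p: "smooth_on I p" "\<And>r. r \<in> I \<Longrightarrow> p r \<noteq> 0"
    and pH: "\<And>r. r \<in> I \<Longrightarrow> p r * (1 - \<kappa>\<^sup>2) * cos r = sin r * H r"
    and H: "\<And>r. r \<in> I \<Longrightarrow> (H has_real_derivative H1 r / sin r) (at r)"
      "\<And>r. r \<in> I \<Longrightarrow> (H1 has_real_derivative \<kappa>\<^sup>2 * cos (2 * r) * H r / sin r) (at r)"
  shows "biharmonic_profile I (\<lambda>r. r) \<kappa> (\<lambda>r. \<bar>p r\<bar>)"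
proof -
  let ?G = "\<lambda>r. sgn (p r) * H r" and ?G1 = "\<lambda>r. sgn (p r) * H1 r"
  have sn: "sin r > 0" if "r \<in> I" for r
    using that I(2) by (auto intro!: sin_gt_zero)
  note sgn = DERIV_sgn_mult[OF I(1) smooth_on_imp_continuous_on[OF p(1)] _ p(2)]
  obtain r0 where r0: "r0 \<in> I" using I(3) by blast
  show ?thesis
  proof (rule biharmonic_profileI[where G = ?G and r = r0 and ?R1.0 = sin and ?R2.0 = "\<lambda>r. sin r * cos r"])
    fix r assume r: "r \<in> I"
    show "((\<lambda>r. r) has_real_derivative sin r / sin r) (at r)"
      and "(sin has_real_derivative sin r * cos r / sin r) (at r)"
      using sn[OF r] by simp_all
    have "\<bar>p r\<bar> * (sin r * cos r - \<kappa>\<^sup>2 * (sin r * cos r)) = sgn (p r) * sin r * (p r * (1 - \<kappa>\<^sup>2) * cos r)"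
      by (simp add: abs_sgn algebra_simps)
    also have "\<dots> = (sin r)\<^sup>2 * ?G r"
      unfolding pH[OF r] by (simp add: power2_eq_square)
    finally show "\<bar>p r\<bar> * (sin r * cos r - \<kappa>\<^sup>2 * (sin r * cos r)) = (sin r)\<^sup>2 * ?G r" .
    show "(?G has_real_derivative ?G1 r / sin r) (at r)"
      using sgn[OF r r H(1)[OF r]] by simp
    show "(?G1 has_real_derivative \<kappa>\<^sup>2 * cos (2 * r) * ?G r / sin r) (at r)"
      using sgn[OF r r H(2)[OF r]] by (simp add: mult_ac)
  next
    show "?G r0 \<noteq> 0"
      using pH[OF r0] p(2)[OF r0] I(4)[OF r0] \<kappa> sn[OF r0] by (auto simp: sgn_zero_iff)
    show "(sin r0)\<^sup>2 \<noteq> (\<kappa> * sin r0)\<^sup>2"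
      using \<kappa> sn[OF r0] by (simp add: power_mult_distrib)
  qed (use I p r0 in \<open>auto intro!: smooth_on_id smooth_on_abs\<close>)
qed

lemma tan_half:
  assumes "0 < r" "r < pi"
  shows "tan (r / 2) > 0" "cos (r / 2) > 0" "sin (r / 2) > 0" "r = 2 * arctan (tan (r / 2))"
    "sin r = 2 * tan (r / 2) / (1 + (tan (r / 2))\<^sup>2)"
    "cos r = (1 - (tan (r / 2))\<^sup>2) / (1 + (tan (r / 2))\<^sup>2)"
proof -
  show p: "tan (r / 2) > 0" "cos (r / 2) > 0" "sin (r / 2) > 0"
    using assms by (auto intro!: tan_gt_zero cos_gt_zero sin_gt_zero)
  show "r = 2 * arctan (tan (r / 2))"
    using assms arctan_tan[of "r / 2"] by simp
  have n: "cos (r / 2) \<noteq> 0" using p by simp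
  show "sin r = 2 * tan (r / 2) / (1 + (tan (r / 2))\<^sup>2)" "cos r = (1 - (tan (r / 2))\<^sup>2) / (1 + (tan (r / 2))\<^sup>2)"
    using sin_tan_half[of "r / 2"] cos_tan_half[of "r / 2"] n by simp_all
qed

text \<open>On the cylinder with coordinate \<open>t = ln (tan (r / 2))\<close> this is the derivative of \<open>exp (c t)\<close>.\<close>

lemma DERIV_tan_half_powr:
  assumes "0 < r" "r < pi"
  shows "((\<lambda>r. tan (r / 2) powr c) has_real_derivative c * tan (r / 2) powr c / sin r) (at r)"
proof -
  let ?t = "tan (r / 2)"
  note h = tan_half[OF assms]
  have "((\<lambda>r. tan (r / 2)) has_real_derivative (1 + ?t\<^sup>2) / 2) (at r)"
    using h(2) by (auto intro!: derivative_eq_intros simp: tan_def field_simps power2_eq_square)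
  from DERIV_powr[OF this h(1) DERIV_const, of c]
  have "((\<lambda>r. tan (r / 2) powr c) has_real_derivative ?t powr c * ((1 + ?t\<^sup>2) / 2 * c / ?t)) (at r)"
    by simp
  then show ?thesis
    by (rule DERIV_cong) (use h(1) h(5) in \<open>simp add: field_simps\<close>)
qed

text \<open>The second and the third map belong to the two square roots \<open>c\<close> of \<open>3\<close>. With \<open>t = ln (tan (r / 2))\<close>
  one has \<open>cos r = - tanh t\<close>, and the linear equation is the Poeschl-Teller equation
  \<open>F'' = (3 - 6 / cosh\<^sup>2 t) F\<close>. It has a solution that is \<open>exp (c t)\<close> times a polynomial of degree two in
  \<open>tanh t\<close>.\<close>

lemma biharmonic_profile_sqrt3:
  assumes c: "c\<^sup>2 = 3"
  shows "biharmonic_profile {r. 0 < r \<and> r < pi \<and> r \<notin> {pi / 2, 2 * arctan (sqrt (2 + c))}} (\<lambda>r. r) c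
    (\<lambda>r. \<bar>tan (r / 2) powr (1 + c) * ((tan (r / 2))\<^sup>2 + 7 + 4 * c) * ((tan (r / 2))\<^sup>2 - 2 - c)
      / ((1 + (tan (r / 2))\<^sup>2)\<^sup>2 * ((tan (r / 2))\<^sup>2 - 1))\<bar>)" (is "biharmonic_profile ?I _ _ (\<lambda>r. \<bar>?p r\<bar>)")
proof -
  have "c\<^sup>2 \<le> (7 / 4)\<^sup>2" unfolding c by (simp add: power2_eq_square)
  then have "\<bar>c\<bar> \<le> \<bar>7 / 4\<bar>" by (simp only: abs_le_square_iff)
  then have c_bounds: "7 + 4 * c \<ge> 0" "2 + c > 0" by linarith+
  have cc: "c * c = 3" "c * (c * x) = 3 * x" for x
    using c by (simp_all add: power2_eq_square mult.assoc[symmetric])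
  have I_eq: "?I = {0<..<pi} - {pi / 2, 2 * arctan (sqrt (2 + c))}" by auto
  have t: "tan (r / 2) > 0" "(tan (r / 2))\<^sup>2 \<noteq> 1" "(tan (r / 2))\<^sup>2 \<noteq> 2 + c"
    "(tan (r / 2))\<^sup>2 + 7 + 4 * c > 0" "1 + (tan (r / 2))\<^sup>2 > 0" if "r \<in> ?I" for r
  proof -
    note h = tan_half[of r]
    show p: "tan (r / 2) > 0" using h that by auto
    show "(tan (r / 2))\<^sup>2 \<noteq> 1"
    proof
      assume "(tan (r / 2))\<^sup>2 = 1"
      then have "tan (r / 2) = 1" using p by (simp add: power2_eq_1_iff)
      then have "r = 2 * arctan 1" using h(4) that by auto
      then show False using that by (simp add: arctan_one)
    qed
    show "(tan (r / 2))\<^sup>2 \<noteq> 2 + c"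
    proof
      assume "(tan (r / 2))\<^sup>2 = 2 + c"
      then have "tan (r / 2) = sqrt (2 + c)" using p by (metis less_imp_le real_sqrt_unique)
      then show False using h(4) that by auto
    qed
    have "(tan (r / 2))\<^sup>2 > 0" using p by simp
    then show "(tan (r / 2))\<^sup>2 + 7 + 4 * c > 0" "1 + (tan (r / 2))\<^sup>2 > 0" using c_bounds by linarith+
  qed
  \<comment> \<open>With this constant the quadratic polynomial in \<open>cos r\<close>, multiplied by the square of
    \<open>1 + tan\<^sup>2 (r / 2)\<close>, is the product of the two polynomials in \<open>tan\<^sup>2 (r / 2)\<close> in the
    numerator of the weight.\<close>
  let ?H = "\<lambda>r. - (5 + 3 * c) / 2 * (tan (r / 2) powr c * (3 * (cos r)\<^sup>2 + 3 * c * cos r + 2))"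
  let ?H1 = "\<lambda>r. - (5 + 3 * c) / 2 * (tan (r / 2) powr c * (6 * (cos r)^3 + 6 * c * (cos r)\<^sup>2 + 3 * cos r - c))"
  show ?thesis
  proof (rule biharmonic_profile_id[where H = ?H and ?H1.0 = ?H1])
    show "open ?I" unfolding I_eq by (intro open_Diff open_greaterThanLessThan finite_imp_closed) simp
    show "?I \<noteq> {}"
    proof
      assume "?I = {}"
      then have "{0<..<pi} \<subseteq> {pi / 2, 2 * arctan (sqrt (2 + c))}" unfolding I_eq by blast
      then have "finite {0<..<pi}" using finite_subset by blast
      then show False using infinite_Ioo[of 0 pi] pi_gt_zero by blast
    qed
    show "c\<^sup>2 \<noteq> 1" using c by simp
    show "smooth_on ?I ?p"
    proof -
      have o: "open ?I" by fact
      have cos: "cos (r / 2) \<noteq> 0" if "r \<in> ?I" for r using tan_half(2)[of r] that by auto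
      have nz: "(1 + (tan (r / 2))\<^sup>2)\<^sup>2 * ((tan (r / 2))\<^sup>2 - 1) \<noteq> 0" if "r \<in> ?I" for r
        using t[OF that] by simp
      show ?thesis
        by (intro smooth_intros o cos nz t(1)) auto
    qed
    show "?p r \<noteq> 0" if "r \<in> ?I" for r
      using t[OF that] by auto
    fix r assume r: "r \<in> ?I"
    then have r': "0 < r" "r < pi" by auto
    have sn: "sin r > 0" using r' by (intro sin_gt_zero)
    show "cos r \<noteq> 0"
      using tan_half(6)[OF r'] t[OF r] by simp
    show "?p r * (1 - c\<^sup>2) * cos r = sin r * ?H r"
    proof -
      define w where "w = tan (r / 2)"
      have w: "w > 0" "w\<^sup>2 \<noteq> 1" "1 + w\<^sup>2 \<noteq> 0" using t[OF r] by (auto simp: w_def)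
      have "w powr (1 + c) = w * w powr c" using w by (simp add: powr_add)
      then have 1: "?p r = w * w powr c * (w\<^sup>2 + 7 + 4 * c) * (w\<^sup>2 - 2 - c) / ((1 + w\<^sup>2)\<^sup>2 * (w\<^sup>2 - 1))"
        by (simp add: w_def)
      have 2: "sin r = 2 * w / (1 + w\<^sup>2)" "cos r = (1 - w\<^sup>2) / (1 + w\<^sup>2)"
        using tan_half[OF r'] by (simp_all add: w_def)
      define X V where "X = w\<^sup>2 - 1" and "V = 1 + w\<^sup>2"
      have X: "X \<noteq> 0" "V \<noteq> 0" "cos r = - X / V" using w 2 by (auto simp: X_def V_def)
      have N: "2 * (w\<^sup>2 + 7 + 4 * c) * (w\<^sup>2 - 2 - c) = - (5 + 3 * c) * (3 * X\<^sup>2 - 3 * c * X * V + 2 * V\<^sup>2)"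
        unfolding X_def V_def by (simp add: algebra_simps power2_eq_square cc)
      have "?p r * (1 - c\<^sup>2) * cos r = w * w powr c * (2 * (w\<^sup>2 + 7 + 4 * c) * (w\<^sup>2 - 2 - c)) / V ^ 3"
        unfolding 1 c X(3) V_def[symmetric] X_def[symmetric] using X
        by (simp add: field_simps power2_eq_square power3_eq_cube)
      also have "\<dots> = sin r * ?H r"
        unfolding N 2(1) X(3) V_def[symmetric] w_def[symmetric] using X
        by (simp add: field_simps power2_eq_square power3_eq_cube)
      finally show ?thesis .
    qed
    have dcos: "((\<lambda>r. tan (r / 2) powr c * P (cos r)) has_real_derivative
        tan (r / 2) powr c * (c * P (cos r) - (sin r)\<^sup>2 * P') / sin r) (at r)"
      if "(P has_real_derivative P') (at (cos r))" for P P'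
    proof -
      have "((\<lambda>r. P (cos r)) has_real_derivative P' * (- sin r)) (at r)"
        by (rule DERIV_chain2[OF that DERIV_cos])
      from DERIV_mult[OF DERIV_tan_half_powr[OF r', of c] this] show ?thesis
        by (rule DERIV_cong)
          (use sn in \<open>simp add: field_simps power2_eq_square\<close>)
    qed
    have q: "((\<lambda>x. 3 * x\<^sup>2 + 3 * c * x + 2) has_real_derivative 6 * cos r + 3 * c) (at (cos r))"
      "((\<lambda>x. 6 * x^3 + 6 * c * x\<^sup>2 + 3 * x - c) has_real_derivative 18 * (cos r)\<^sup>2 + 12 * c * cos r + 3) (at (cos r))"
      by (auto intro!: derivative_eq_intros)
    show "(?H has_real_derivative ?H1 r / sin r) (at r)"
    proof (rule DERIV_cong[OF DERIV_cmult[OF dcos[OF q(1)]]])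
      have "c * (3 * (cos r)\<^sup>2 + 3 * c * cos r + 2) - (sin r)\<^sup>2 * (6 * cos r + 3 * c)
          = 6 * (cos r)^3 + 6 * c * (cos r)\<^sup>2 + 3 * cos r - c"
        unfolding sin_squared_eq by (simp add: algebra_simps power2_eq_square power3_eq_cube cc)
      then show "- (5 + 3 * c) / 2 * (tan (r / 2) powr c * (c * (3 * (cos r)\<^sup>2 + 3 * c * cos r + 2)
          - (sin r)\<^sup>2 * (6 * cos r + 3 * c)) / sin r) = ?H1 r / sin r"
        by simp
    qed
    show "(?H1 has_real_derivative c\<^sup>2 * cos (2 * r) * ?H r / sin r) (at r)"
    proof (rule DERIV_cong[OF DERIV_cmult[OF dcos[OF q(2)]]])
      have "c * (6 * (cos r)^3 + 6 * c * (cos r)\<^sup>2 + 3 * cos r - c)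
          - (sin r)\<^sup>2 * (18 * (cos r)\<^sup>2 + 12 * c * cos r + 3)
          = c\<^sup>2 * cos (2 * r) * (3 * (cos r)\<^sup>2 + 3 * c * cos r + 2)"
        unfolding sin_squared_eq c cos_double_cos
        by (simp add: algebra_simps power2_eq_square power3_eq_cube cc)
      then show "- (5 + 3 * c) / 2 * (tan (r / 2) powr c * (c * (6 * (cos r)^3 + 6 * c * (cos r)\<^sup>2 + 3 * cos r - c)
          - (sin r)\<^sup>2 * (18 * (cos r)\<^sup>2 + 12 * c * cos r + 3)) / sin r)
          = c\<^sup>2 * cos (2 * r) * ?H r / sin r"
        by simp
    qed
  qed auto
qed

text \<open>For \<open>\<kappa> = 1 / 2\<close> the substitution \<open>F = u / sqrt (sin r)\<close> removes the singular part of the potential: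
  the linear equation becomes \<open>u'' + 3 / 4 u = 0\<close>. Because of \<open>sqrt 3 / 2 < 1\<close> the solution
  \<open>u = sin (sqrt 3 / 2 r)\<close> has no zero for \<open>0 < r < pi\<close>.\<close>

lemma biharmonic_profile_half:
  "biharmonic_profile {r. 0 < r \<and> r < pi \<and> r \<noteq> pi / 2} (\<lambda>r. r) (1 / 2)
    (\<lambda>r. \<bar>tan r * sin (sqrt 3 / 2 * r) / sqrt (sin r)\<bar>)" (is "biharmonic_profile ?I _ _ (\<lambda>r. \<bar>?p r\<bar>)")
proof -
  define b where "b = sqrt 3 / 2"
  have b: "b\<^sup>2 = 3 / 4" "0 < b" "b < 1"
    by (auto simp: b_def power_divide real_less_lsqrt)
  have I_eq: "?I = {0<..<pi} - {pi / 2}" by auto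
  have pos: "sin r > 0" "sin (b * r) > 0" "cos r \<noteq> 0" if "r \<in> ?I" for r
  proof -
    show "sin r > 0" using that by (auto intro!: sin_gt_zero)
    have "b * r < 1 * pi" using that b by (intro mult_strict_mono) auto
    then show "sin (b * r) > 0" using that b by (auto intro!: sin_gt_zero)
    show "cos r \<noteq> 0"
    proof
      assume "cos r = 0"
      then have "r = pi / 2" using that cos_inj_pi[of r "pi / 2"] by auto
      then show False using that by simp
    qed
  qed
  let ?H = "\<lambda>r. 3 / 4 * (sin (b * r) / sqrt (sin r))"
  let ?H1 = "\<lambda>r. 3 / 4 * (b * cos (b * r) * sqrt (sin r) - sin (b * r) * cos r / (2 * sqrt (sin r)))"
  have o: "open ?I" unfolding I_eq by (intro open_Diff open_greaterThanLessThan finite_imp_closed) simp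
  have "biharmonic_profile ?I (\<lambda>r. r) (1 / 2) (\<lambda>r. \<bar>tan r * sin (b * r) / sqrt (sin r)\<bar>)"
  proof (rule biharmonic_profile_id[where H = ?H and ?H1.0 = ?H1])
    show "open ?I" by fact
    have "pi / 3 \<in> ?I" by simp
    then show "?I \<noteq> {}" by blast
    have "sqrt (sin r) \<noteq> 0" if "r \<in> ?I" for r using pos[OF that] by simp
    then show "smooth_on ?I (\<lambda>r. tan r * sin (b * r) / sqrt (sin r))"
      by (intro smooth_intros o pos) auto
    fix r assume r: "r \<in> ?I"
    define S where "S = sqrt (sin r)"
    have S: "S > 0" "sin r = S\<^sup>2" using pos(1)[OF r] by (auto simp: S_def)
    show "cos r \<noteq> 0" by (rule pos(3)[OF r])
    show "tan r * sin (b * r) / sqrt (sin r) \<noteq> 0"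
      using pos[OF r] by (simp add: tan_def)
    show "tan r * sin (b * r) / sqrt (sin r) * (1 - (1 / 2)\<^sup>2) * cos r = sin r * ?H r"
      using pos[OF r] by (simp add: tan_def power2_eq_square)
    have dS: "((\<lambda>r. sqrt (sin r)) has_real_derivative cos r / (2 * S)) (at r)"
      using pos(1)[OF r] by (auto intro!: derivative_eq_intros simp: S_def field_simps)
    have db: "((\<lambda>r. sin (b * r)) has_real_derivative b * cos (b * r)) (at r)"
      "((\<lambda>r. b * cos (b * r)) has_real_derivative - b\<^sup>2 * sin (b * r)) (at r)"
      by (auto intro!: derivative_eq_intros simp: power2_eq_square)
    have sq: "sqrt (sin r) = S" by (simp add: S_def)
    have S0: "sqrt (sin r) \<noteq> 0" "2 * sqrt (sin r) \<noteq> 0" using S(1) by (simp_all add: sq)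
    show "(?H has_real_derivative ?H1 r / sin r) (at r)"
    proof (rule DERIV_cong[OF DERIV_cmult[OF DERIV_divide[OF db(1) dS S0(1)]]])
      show "3 / 4 * ((b * cos (b * r) * sqrt (sin r) - sin (b * r) * (cos r / (2 * S)))
          / (sqrt (sin r) * sqrt (sin r))) = ?H1 r / sin r"
        unfolding sq unfolding S(2) by (simp add: power2_eq_square mult_ac)
    qed
    have kk: "cos r * cos r = 1 - S ^ 4"
    proof -
      have "S ^ 4 = (sin r)\<^sup>2" by (simp add: S(2) flip: power_mult)
      then show ?thesis using cos_squared_eq[of r] by (simp add: power2_eq_square)
    qed
    have c2: "cos (2 * r) = 1 - 2 * S ^ 4"
      unfolding cos_double_cos power2_eq_square kk by simp
    show "(?H1 has_real_derivative (1 / 2)\<^sup>2 * cos (2 * r) * ?H r / sin r) (at r)"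
    proof (rule DERIV_cong[OF DERIV_cmult[OF DERIV_diff[OF DERIV_mult[OF db(2) dS]
          DERIV_divide[OF DERIV_mult[OF db(1) DERIV_cos] DERIV_cmult[OF dS] S0(2)]]]])
      define u v k where "u = sin (b * r)" and "v = cos (b * r)" and "k = cos r"
      have "3 / 4 * (- b\<^sup>2 * u * S + k / (2 * S) * (b * v)
          - ((b * v * k + - S\<^sup>2 * u) * (2 * S) - u * k * (2 * (k / (2 * S)))) / (2 * S * (2 * S)))
          = 3 / 4 * (u * (1 / 2 - b\<^sup>2) * S + u * (k * k) / (4 * S ^ 3))"
        using S(1) by (simp add: field_simps power2_eq_square power3_eq_cube)
      also have "\<dots> = (1 / 2)\<^sup>2 * (1 - 2 * S ^ 4) * (3 / 4 * (u / S)) / S\<^sup>2"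
        unfolding k_def kk b(1) using S(1)
        by (simp add: field_simps power2_eq_square power3_eq_cube power4_eq_xxxx)
      finally show "3 / 4 * (- b\<^sup>2 * sin (b * r) * sqrt (sin r) + cos r / (2 * S) * (b * cos (b * r))
          - ((b * cos (b * r) * cos r + - sin r * sin (b * r)) * (2 * sqrt (sin r))
            - sin (b * r) * cos r * (2 * (cos r / (2 * S)))) / (2 * sqrt (sin r) * (2 * sqrt (sin r))))
          = (1 / 2)\<^sup>2 * cos (2 * r) * ?H r / sin r"
        unfolding sq c2 unfolding S(2) u_def v_def k_def .
    qed
  qed (auto simp: power2_eq_square)
  then show ?thesis by (simp add: b_def)
qed

text \<open>Here \<open>cos (2 \<rho>) = sin\<^sup>2 (r / 2)\<close>, which is \<open>exp (2 t) / (1 + exp (2 t))\<close> for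
  \<open>t = ln (tan (r / 2))\<close>, and the linear equation \<open>F'' = 4 cos (2 \<rho>) F\<close> has the solution
  \<open>1 + exp (2 t) = 1 / cos\<^sup>2 (r / 2)\<close>. In the proof everything is expressed by \<open>S = sin (r / 2)\<close>,
  \<open>C = cos (r / 2)\<close> and \<open>D\<close> with \<open>sin (2 \<rho>) = C D\<close>.\<close>

lemma biharmonic_profile_arccos:
  "biharmonic_profile {0<..<pi} (\<lambda>r. arccos ((sin (r / 2))\<^sup>2) / 2) 2
    (\<lambda>r. 4 * (1 + (tan (r / 2))\<^sup>2) * (1 + 2 * (tan (r / 2))\<^sup>2) powr (3 / 2)
      / (3 * tan (r / 2) ^ 4 + 9 * (tan (r / 2))\<^sup>2 + 6 + (cot (r / 2))\<^sup>2))"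
  (is "biharmonic_profile ?I ?\<rho> _ ?f")
proof -
  define S C D where "S r = sin (r / 2)" and "C r = cos (r / 2)" and "D r = sqrt (1 + (S r)\<^sup>2)" for r :: real
  let ?R1 = "\<lambda>r. - ((S r)\<^sup>2 * C r / D r)"
  let ?R2 = "\<lambda>r. - 2 * (S r)\<^sup>2 * C r * (1 - (S r)\<^sup>2 - (S r) ^ 4) / (D r) ^ 3"
  let ?G = "\<lambda>r. - 2 / (C r)\<^sup>2"
  let ?G1 = "\<lambda>r. - 4 * (S r)\<^sup>2 / (C r)\<^sup>2"
  have pos: "S r > 0" "C r > 0" "D r > 0" "sin r = 2 * S r * C r" "(D r)\<^sup>2 = 1 + (S r)\<^sup>2"
    "(C r)\<^sup>2 = 1 - (S r)\<^sup>2" "(S r)\<^sup>2 < 1" if "r \<in> ?I" for r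
  proof -
    show S: "S r > 0" and C: "C r > 0"
      using tan_half(2,3)[of r] that by (auto simp: S_def C_def)
    show "D r > 0" by (simp add: D_def add_pos_nonneg)
    show "(D r)\<^sup>2 = 1 + (S r)\<^sup>2" by (simp add: D_def add_nonneg_nonneg)
    show "sin r = 2 * S r * C r" using sin_double[of "r / 2"] by (simp add: S_def C_def)
    show CC: "(C r)\<^sup>2 = 1 - (S r)\<^sup>2" by (simp add: S_def C_def cos_squared_eq)
    have "(C r)\<^sup>2 > 0" using C by simp
    then show "(S r)\<^sup>2 < 1" using CC by linarith
  qed
  have t: "tan (r / 2) = S r / C r" "cot (r / 2) = C r / S r" for r
    by (simp_all add: S_def C_def tan_def cot_def)
  have dS: "(S has_real_derivative C r / 2) (at r)" and dC: "(C has_real_derivative - S r / 2) (at r)" for r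
    unfolding S_def[abs_def] C_def[abs_def] by (auto intro!: derivative_eq_intros)
  have dD: "(D has_real_derivative S r * C r / (2 * D r)) (at r)" if "r \<in> ?I" for r
  proof -
    have p: "1 + (S r)\<^sup>2 > 0" by (simp add: add_pos_nonneg)
    have "((\<lambda>r. 1 + (S r)\<^sup>2) has_real_derivative S r * C r) (at r)"
      by (auto intro!: derivative_eq_intros dS)
    from DERIV_chain2[OF DERIV_real_sqrt[OF p] this] show ?thesis
      unfolding D_def[abs_def] by (rule DERIV_cong) (simp add: field_simps)
  qed
  have f_eq: "?f r = 4 * D r ^ 3 * (S r)\<^sup>2 / (C r * (1 + 3 * (S r)\<^sup>2 - S r ^ 6))" if "r \<in> ?I" for r
  proof -
    note p = pos[OF that]
    define x where "x = S r"
    define y where "y = C r"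
    define d where "d = D r"
    have xyd: "x > 0" "y > 0" "d > 0" "y\<^sup>2 = 1 - x\<^sup>2" "d\<^sup>2 = 1 + x\<^sup>2"
      using p by (auto simp: x_def y_def d_def)
    have 1: "1 + (x / y)\<^sup>2 = 1 / y\<^sup>2"
      using xyd(2) by (simp add: power_divide field_simps) (simp add: xyd(4))
    have "1 + 2 * (x / y)\<^sup>2 = (y\<^sup>2 + 2 * x\<^sup>2) / y\<^sup>2"
      using xyd(2) by (simp add: power_divide field_simps)
    also have "\<dots> = (d / y)\<^sup>2"
      unfolding power_divide xyd(4) xyd(5) by simp
    finally have 2: "(1 + 2 * (x / y)\<^sup>2) powr (3 / 2) = (d / y) ^ 3"
      using xyd by (simp add: powr_powr flip: powr_numeral)
    have "3 * (x / y) ^ 4 + 9 * (x / y)\<^sup>2 + 6 + (y / x)\<^sup>2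
        = (3 * x ^ 6 + 9 * x ^ 4 * y\<^sup>2 + 6 * x\<^sup>2 * (y\<^sup>2)\<^sup>2 + (y\<^sup>2) ^ 3) / (y ^ 4 * x\<^sup>2)"
      using xyd(1,2) by (simp add: field_simps eval_nat_numeral)
    also have "3 * x ^ 6 + 9 * x ^ 4 * y\<^sup>2 + 6 * x\<^sup>2 * (y\<^sup>2)\<^sup>2 + (y\<^sup>2) ^ 3 = 1 + 3 * x\<^sup>2 - x ^ 6"
      unfolding xyd(4) by (simp add: algebra_simps eval_nat_numeral)
    finally have 3: "3 * (x / y) ^ 4 + 9 * (x / y)\<^sup>2 + 6 + (y / x)\<^sup>2 = (1 + 3 * x\<^sup>2 - x ^ 6) / (y ^ 4 * x\<^sup>2)" .
    have "4 * (1 / y\<^sup>2) * (d / y) ^ 3 / (q / (y ^ 4 * x\<^sup>2)) = 4 * d ^ 3 * x\<^sup>2 / (y * q)" for q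
      using xyd(1,2) by (cases "q = 0") (simp_all add: field_simps eval_nat_numeral)
    then show ?thesis
      unfolding t x_def[symmetric] y_def[symmetric] d_def[symmetric] 1 2 3 .
  qed
  have Q: "1 + 3 * (S r)\<^sup>2 - S r ^ 6 > 0" if "r \<in> ?I" for r
  proof -
    have "((S r)\<^sup>2)^3 \<le> 1" by (intro power_le_one zero_le_power2 less_imp_le pos(7)[OF that])
    moreover have "((S r)\<^sup>2)^3 = S r ^ 6" by (simp flip: power_mult)
    moreover have "(S r)\<^sup>2 > 0" using pos(1)[OF that] by simp
    ultimately show ?thesis by linarith
  qed
  have sin_\<alpha>': "sqrt (1 - ((S r)\<^sup>2)\<^sup>2) = C r * D r" if "r \<in> ?I" for r
  proof -
    have "1 - ((S r)\<^sup>2)\<^sup>2 = (C r * D r)\<^sup>2"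
      unfolding power_mult_distrib pos(5)[OF that] pos(6)[OF that] by (simp add: algebra_simps power2_eq_square)
    then show ?thesis
      using pos[OF that] by (simp add: less_imp_le)
  qed
  have abs_S: "\<bar>(S r)\<^sup>2\<bar> \<le> 1" if "r \<in> ?I" for r
    using pos(7)[OF that] by simp
  have sin_\<alpha>: "sin (arccos ((S r)\<^sup>2)) = C r * D r" if "r \<in> ?I" for r
    using sin_arccos_abs[OF abs_S[OF that]] sin_\<alpha>'[OF that] by simp
  have cos_2\<rho>: "cos (2 * ?\<rho> r) = (S r)\<^sup>2" if "r \<in> ?I" for r
    using abs_S[OF that] unfolding S_def by (simp add: cos_arccos_abs)
  show ?thesis
  proof (rule biharmonic_profileI[where ?R1.0 = ?R1 and ?R2.0 = ?R2 and G = ?G and ?G1.0 = ?G1 and r = "pi / 2"])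
    have bnd: "\<bar>(sin (r / 2))\<^sup>2\<bar> < 1" if "r \<in> ?I" for r using pos(7)[OF that] by (simp add: S_def)
    show "smooth_on ?I ?\<rho>"
      by (intro smooth_intros smooth_on_arccos bnd) auto
    show "?\<rho> \<in> ?I \<rightarrow> {0<..<pi}"
    proof
      fix r assume "r \<in> ?I"
      then have "0 < arccos ((sin (r / 2))\<^sup>2) \<and> arccos ((sin (r / 2))\<^sup>2) < pi"
        using bnd[of r] by (intro arccos_lt_bounded) linarith+
      then show "?\<rho> r \<in> {0<..<pi}" by auto
    qed
    have "cos (r / 2) \<noteq> 0" "sin (r / 2) \<noteq> 0" "1 + 2 * (tan (r / 2))\<^sup>2 > 0"
      "3 * tan (r / 2) ^ 4 + 9 * (tan (r / 2))\<^sup>2 + 6 + (cot (r / 2))\<^sup>2 \<noteq> 0" if "r \<in> ?I" for r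
    proof -
      show "cos (r / 2) \<noteq> 0" "sin (r / 2) \<noteq> 0" using pos[OF that] by (auto simp: S_def C_def)
      show "1 + 2 * (tan (r / 2))\<^sup>2 > 0" by (simp add: add_pos_nonneg)
      show "3 * tan (r / 2) ^ 4 + 9 * (tan (r / 2))\<^sup>2 + 6 + (cot (r / 2))\<^sup>2 \<noteq> 0"
        by (smt (verit) zero_le_power2 zero_le_even_power even_numeral)
    qed
    then show "smooth_on ?I ?f"
      by (intro smooth_intros) auto
    fix r assume r: "r \<in> ?I"
    note p = pos[OF r]
    show "?f r > 0"
      unfolding f_eq[OF r] using p Q[OF r] by simp
    define x where "x = S r"
    define y where "y = C r"
    define d where "d = D r"
    note xyd = p[folded x_def y_def d_def]
    have nz: "x \<noteq> 0" "y \<noteq> 0" "d \<noteq> 0" using xyd by auto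
    note fold = x_def[symmetric] y_def[symmetric] d_def[symmetric]
    have dS2: "((\<lambda>r. (S r)\<^sup>2) has_real_derivative x * y) (at r)"
      by (auto intro!: derivative_eq_intros dS simp: x_def y_def)
    have dC2: "((\<lambda>r. (C r)\<^sup>2) has_real_derivative - (x * y)) (at r)"
      by (auto intro!: derivative_eq_intros dC simp: x_def y_def)
    show "(?\<rho> has_real_derivative ?R1 r / sin r) (at r)"
    proof -
      have "(arccos has_real_derivative inverse (- sqrt (1 - (x\<^sup>2)\<^sup>2))) (at ((S r)\<^sup>2))"
        using xyd unfolding x_def by (intro DERIV_arccos) (auto intro: less_le_trans[of _ 0])
      from DERIV_cdivide[OF DERIV_chain2[OF this dS2], of 2] show ?thesis
        unfolding S_def[symmetric]
        by (rule DERIV_cong)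
          (use nz sin_\<alpha>'[OF r] in \<open>simp add: fold xyd(4) field_simps power2_eq_square\<close>)
    qed
    show "(?R1 has_real_derivative ?R2 r / sin r) (at r)"
    proof (rule DERIV_cong[OF DERIV_minus[OF DERIV_divide[OF DERIV_mult[OF dS2 dC] dD[OF r]]]])
      show "D r \<noteq> 0" using p by simp
      have "- (((x * y * y + - x / 2 * x\<^sup>2) * d - x\<^sup>2 * y * (x * y / (2 * d))) / (d * d))
          = - x * ((y\<^sup>2 - x\<^sup>2 / 2) * d\<^sup>2 - x\<^sup>2 * y\<^sup>2 / 2) / d ^ 3"
        using nz by (simp add: field_simps eval_nat_numeral)
      also have "\<dots> = - 2 * x\<^sup>2 * y * (1 - x\<^sup>2 - x ^ 4) / d ^ 3 / (2 * x * y)"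
        unfolding xyd(5) xyd(6) using nz by (simp add: field_simps eval_nat_numeral)
      finally show "- (((x * y * C r + - S r / 2 * (S r)\<^sup>2) * D r
          - (S r)\<^sup>2 * C r * (S r * C r / (2 * D r))) / (D r * D r)) = ?R2 r / sin r"
        unfolding fold xyd(4) .
    qed
    show "?f r * (?R2 r - 2\<^sup>2 * (sin (?\<rho> r) * cos (?\<rho> r))) = (sin r)\<^sup>2 * ?G r"
    proof -
      define q where "q = 1 + 3 * x\<^sup>2 - x ^ 6"
      have q: "q \<noteq> 0" using Q[OF r] by (simp add: q_def x_def)
      have "2\<^sup>2 * (sin (?\<rho> r) * cos (?\<rho> r)) = 2 * (y * d)"
        using sin_double[of "?\<rho> r"] sin_\<alpha>[OF r, unfolded fold, unfolded x_def S_def] by simp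
      moreover have "?R2 r - 2 * (y * d) = - 2 * y * (x\<^sup>2 * (1 - x\<^sup>2 - x ^ 4) + (d\<^sup>2)\<^sup>2) / d ^ 3"
        unfolding fold using nz by (simp add: field_simps eval_nat_numeral)
      moreover have "x\<^sup>2 * (1 - x\<^sup>2 - x ^ 4) + (d\<^sup>2)\<^sup>2 = q"
        unfolding xyd(5) q_def by (simp add: algebra_simps eval_nat_numeral)
      ultimately have "?R2 r - 2\<^sup>2 * (sin (?\<rho> r) * cos (?\<rho> r)) = - 2 * y * q / d ^ 3"
        by (simp only:)
      then show ?thesis
        unfolding f_eq[OF r] xyd(4) fold q_def[symmetric] using nz q
        by (simp add: power_mult_distrib)
    qed
    show "(?G has_real_derivative ?G1 r / sin r) (at r)"
      by (rule DERIV_cong[OF DERIV_divide[OF DERIV_const dC2]])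
        (use nz in \<open>simp_all add: fold xyd(4) field_simps eval_nat_numeral\<close>)
    show "(?G1 has_real_derivative 2\<^sup>2 * cos (2 * ?\<rho> r) * ?G r / sin r) (at r)"
    proof (rule DERIV_cong[OF DERIV_divide[OF DERIV_cmult[OF dS2] dC2]])
      show "(C r)\<^sup>2 \<noteq> 0" using p by simp
      have "(- 4 * (x * y) * y\<^sup>2 - - 4 * x\<^sup>2 * - (x * y)) / (y\<^sup>2 * y\<^sup>2) = - 4 * x * (y\<^sup>2 + x\<^sup>2) / y ^ 3"
        using nz by (simp add: field_simps eval_nat_numeral)
      also have "\<dots> = 2\<^sup>2 * x\<^sup>2 * (- 2 / y\<^sup>2) / (2 * x * y)"
        unfolding xyd(6)[THEN eq_diff_eq[THEN iffD1]] using nz by (simp add: field_simps eval_nat_numeral)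
      finally show "(- 4 * (x * y) * (C r)\<^sup>2 - - 4 * (S r)\<^sup>2 * - (x * y)) / ((C r)\<^sup>2 * (C r)\<^sup>2)
          = 2\<^sup>2 * cos (2 * ?\<rho> r) * ?G r / sin r"
        unfolding cos_2\<rho>[OF r] fold xyd(4) .
    qed
  next
    have r: "pi / 2 \<in> ?I" by simp
    note p = pos[OF r]
    show "?G (pi / 2) \<noteq> 0" using p by simp
    show "(?R1 (pi / 2))\<^sup>2 \<noteq> (2 * sin (?\<rho> (pi / 2)))\<^sup>2"
    proof
      assume eq: "(?R1 (pi / 2))\<^sup>2 = (2 * sin (?\<rho> (pi / 2)))\<^sup>2"
      define x where "x = S (pi / 2)"
      define y where "y = C (pi / 2)"
      define d where "d = D (pi / 2)"
      note xyd = p[folded x_def y_def d_def]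
      have "(2 * sin (?\<rho> (pi / 2)))\<^sup>2 = 2 * (1 - x\<^sup>2)"
        using cos_2\<rho>[OF r] unfolding cos_double_sin x_def[symmetric] by (simp add: power_mult_distrib)
      moreover have "(?R1 (pi / 2))\<^sup>2 = (x\<^sup>2)\<^sup>2 * (1 - x\<^sup>2) / (1 + x\<^sup>2)"
        unfolding x_def[symmetric] y_def[symmetric] d_def[symmetric]
        by (simp add: power_mult_distrib power_divide xyd(5,6))
      ultimately have "(x\<^sup>2)\<^sup>2 * (1 - x\<^sup>2) / (1 + x\<^sup>2) = 2 * (1 - x\<^sup>2)"
        using eq by (simp only:)
      moreover have "1 + x\<^sup>2 \<noteq> 0" using zero_le_power2[of x] by linarith
      ultimately have "(x\<^sup>2)\<^sup>2 * (1 - x\<^sup>2) = 2 * (1 - x\<^sup>2) * (1 + x\<^sup>2)"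
        by (simp only: divide_eq_eq simp_thms if_False)
      then have "(x\<^sup>2)\<^sup>2 * (1 - x\<^sup>2) = 2 * (1 + x\<^sup>2) * (1 - x\<^sup>2)"
        by (simp only: mult_ac)
      then have "(x\<^sup>2)\<^sup>2 = 2 * (1 + x\<^sup>2)" using xyd(7) by simp
      moreover have "(x\<^sup>2)\<^sup>2 < 1" unfolding abs_square_less_1 using xyd(7) by simp
      ultimately have "2 * (1 + x\<^sup>2) < 1" by (simp only:)
      moreover have "0 \<le> x\<^sup>2" by simp
      ultimately show False by argo
    qed
  qed auto
qed

section \<open>The biharmonic maps\<close>

definition radii :: "nat \<Rightarrow> real set" where
  "radii k = {r. 0 < r \<and> r < pi \<and> r \<notin> singular_radii k}"

lemma sphere_chart_eq: "sphere_chart k a = radii k \<times> {a<..<a + 2 * pi}"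
  by (auto simp: sphere_chart_def radii_def)

lemma biharmonic_profile_phi:
  assumes "k \<in> {1, 2, 3, 4}"
  obtains \<rho> \<kappa> where "biharmonic_profile (radii k) \<rho> \<kappa> (\<lambda>r. fk k (r, 0))"
    and "\<And>x. phi k x = (\<rho> (fst x), \<kappa> * snd x)"
proof -
  consider "k = 1" | "k = 2" | "k = 3" | "k = 4" using assms by auto
  then show thesis
  proof cases
    case 1
    have "radii k = {0<..<pi}" by (auto simp: radii_def singular_radii_def 1)
    then show thesis
      using biharmonic_profile_arccos
      by (intro that[of "\<lambda>r. arccos ((sin (r / 2))\<^sup>2) / 2" 2]) (simp_all add: 1 fk_def Let_def phi_def case_prod_unfold)
  next
    case 2
    have "radii k = {r. 0 < r \<and> r < pi \<and> r \<notin> {pi / 2, 2 * arctan (sqrt (2 + sqrt 3))}}"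
      by (simp add: radii_def singular_radii_def 2)
    then show thesis
      using biharmonic_profile_sqrt3[of "sqrt 3"]
      by (intro that[of "\<lambda>r. r" "sqrt 3"]) (simp_all add: 2 fk_def Let_def phi_def case_prod_unfold)
  next
    case 3
    have "radii k = {r. 0 < r \<and> r < pi \<and> r \<notin> {pi / 2, 2 * arctan (sqrt (2 + (- sqrt 3)))}}"
      by (simp add: radii_def singular_radii_def 3)
    then show thesis
      using biharmonic_profile_sqrt3[of "- sqrt 3"]
      by (intro that[of "\<lambda>r. r" "- sqrt 3"]) (simp_all add: 3 fk_def Let_def phi_def case_prod_unfold)
  next
    case 4
    have "radii k = {r. 0 < r \<and> r < pi \<and> r \<noteq> pi / 2}"
      by (simp add: radii_def singular_radii_def 4)
    then show thesis
      using biharmonic_profile_half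
      by (intro that[of "\<lambda>r. r" "1 / 2"]) (simp_all add: 4 fk_def Let_def phi_def case_prod_unfold)
  qed
qed

theorem corollary3p7:
  fixes i j :: "'n::finite" and a :: real and k :: nat
  assumes "CARD('n) \<ge> 3" and "i \<noteq> j" and "k \<in> {1, 2, 3, 4}"
  shows "f_biharmonic_to_sphere (fk k) (sphere_chart k a) g0 (polar \<circ> phi k) \<and>
    proper_biharmonic_to_sphere (sphere_chart k a) (conformal_metric (fk k) g0)
      (std_embedding i j \<circ> (polar \<circ> phi k)) \<and>
    \<not> weakly_conformal_to_sphere (sphere_chart k a) (conformal_metric (fk k) g0)
      (std_embedding i j \<circ> (polar \<circ> phi k))"
proof -
  obtain \<rho> \<kappa> where profile: "biharmonic_profile (radii k) \<rho> \<kappa> (\<lambda>r. fk k (r, 0))"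
    and phi: "\<And>x. phi k x = (\<rho> (fst x), \<kappa> * snd x)"
    using biharmonic_profile_phi[OF assms(3)] by blast
  have fk: "fk k = (\<lambda>x. fk k (fst x, 0))"
    by (rule ext) (simp only: fk_def case_prod_unfold fst_conv)
  have metric: "conformal_metric (fk k) g0 = polar_metric (\<lambda>r. fk k (r, 0))"
    by (subst fk) (simp add: polar_metric_def)
  have polar: "polar \<circ> phi k = (\<lambda>x. (sin (\<rho> (fst x)) *\<^sub>R (cos (\<kappa> * snd x) *\<^sub>R (1, 0) + sin (\<kappa> * snd x) *\<^sub>R (0, 1)), cos (\<rho> (fst x))))"
    by (simp add: fun_eq_iff polar_def phi)
  have axis: "axis i (c * u) + axis j (c * v) = c *\<^sub>R (u *\<^sub>R axis i 1 + v *\<^sub>R (axis j 1 :: real ^ 'n))" for c u v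
    by (simp add: vec_eq_iff axis_def algebra_simps)
  have embedded: "std_embedding i j \<circ> (polar \<circ> phi k) = (\<lambda>x. (sin (\<rho> (fst x)) *\<^sub>R
      (cos (\<kappa> * snd x) *\<^sub>R axis i 1 + sin (\<kappa> * snd x) *\<^sub>R axis j 1), cos (\<rho> (fst x))))"
    by (simp add: fun_eq_iff polar_def phi std_embedding_def axis)
  have J: "open {a<..<a + 2 * pi}" "{a<..<a + 2 * pi} \<noteq> {}" by (simp_all add: not_le)
  have "f_biharmonic_to_sphere (\<lambda>x. fk k (fst x, 0)) (sphere_chart k a) g0 (polar \<circ> phi k)"
    unfolding sphere_chart_eq polar by (rule biharmonic_profile_sphere_map(1)[OF profile J]) simp_all
  then have "f_biharmonic_to_sphere (fk k) (sphere_chart k a) g0 (polar \<circ> phi k)"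
    by (simp only: fk[symmetric])
  moreover have "proper_biharmonic_to_sphere (sphere_chart k a) (conformal_metric (fk k) g0)
      (std_embedding i j \<circ> (polar \<circ> phi k))"
    unfolding sphere_chart_eq embedded metric
    by (rule biharmonic_profile_sphere_map(2)[OF profile J]) (use assms(2) in \<open>simp_all add: inner_axis_axis\<close>)
  moreover have "\<not> weakly_conformal_to_sphere (sphere_chart k a) (conformal_metric (fk k) g0)
      (std_embedding i j \<circ> (polar \<circ> phi k))"
    unfolding sphere_chart_eq embedded metric
    by (rule biharmonic_profile_sphere_map(3)[OF profile J]) (use assms(2) in \<open>simp_all add: inner_axis_axis\<close>)
  ultimately show ?thesis by blast
qed

end
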